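(* Let $T$ be the Nielsen transformation of $F_d$ ($d\ge 2$) given by $T(a_1)=a_1a_2$ and $T(a_i)=a_i$ for $i\geq 2$. Then $T^{-1}$ has linear speed, i.e.: (1) for every $[f]\in\tilde{\mathcal{B}}(F_d)$ one has $|T^{-n}[f]|_S=O(n)$; and (2) there is $[f_0]\in\tilde{\mathcal{B}}(F_d)$ with $|T^{-n}[f_0]|_S=\Theta(n)$.
   Context: $F_d$ is the free group on $S=\{a_1,\dots,a_d\}$; elements are reduced words over $\bar S=S\cup S^{-1}$, $|v|_S$ is word length. For a reduced word $v\neq e$, $\#v(w)$ is the number of (possibly overlapping) occurrences of $v$ as a contiguous subword of the reduced word $w$; $\phi v=\#v-\#(v^{-1})$. Functions satisfy $f_1\sim f_2$ iff $f_1-f_2$ is bounded. $\mathcal{C}(F_d,S)$ is the real span of the $\#v$, $v\ne e$ (which are linearly independent); for $f=\sum\alpha(v)\#v$ put $\|f\|_S=\max\{|v|_S:\alpha(v)\neq0\}$ (and $0$ if $f=0$), and $|f|_S=\min\{\|g\|_S: g\in\mathcal{C}(F_d,S),\ g\sim f\}$. $\mathcal{B}(F_d)\subset\mathcal{C}(F_d,S)$ is the span of the $\phi v$; the Brooks space is $\tilde{\mathcal{B}}(F_d)=\mathcal{B}(F_d)/\sim$, with $|[f]|_S=|f|_S$. $\mathrm{Out}(F_d)$ acts on $\tilde{\mathcal{B}}(F_d)$ by $X[f]=[f\circ X^{-1}]$ (this space is known to be invariant), so $T^{-n}[f]=[f\circ T^n]$. For $g:\mathbb{N}\to\mathbb{R}$: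 $g(n)=O(n)$ means $|g(n)|\le Cn$ for some $C>0$ and all large $n$; $g(n)=\Theta(n)$ means $Cn\le g(n)\le C'n$ for some $C,C'>0$ and all large $n$. *)

theory Defs
  imports Complex_Main "HOL-Algebra.Bij" "HOL-Algebra.Coset" "HOL-Library.Landau_Symbols"
begin

section \<open>The free group of rank d, as reduced words\<close>

text \<open>The letter \<open>(i, True)\<close> stands for the generator with index \<open>i\<close>, the letter \<open>(i, False)\<close>
  for its inverse; the generators of the free group of rank \<open>d\<close> have the indices \<open>1, \<dots>, d\<close>.\<close>

type_synonym letter = "nat \<times> bool"
type_synonym word = "letter list"

definition linv :: "letter \<Rightarrow> letter"
  where "linv x = (fst x, \<not> snd x)"

fun reduced :: "word \<Rightarrow> bool"
  where
    "reduced (x # y # w) \<longleftrightarrow> y \<noteq> linv x \<and> reduced (y # w)"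
  | "reduced w \<longleftrightarrow> True"

definition winv :: "word \<Rightarrow> word"
  where "winv w = rev (map linv w)"

fun push :: "letter \<Rightarrow> word \<Rightarrow> word"
  where
    "push x [] = [x]"
  | "push x (y # w) = (if y = linv x then w else x # y # w)"

definition reduce :: "word \<Rightarrow> word"
  where "reduce w = foldr push w []"

definition free_group :: "nat \<Rightarrow> word monoid"
  where "free_group d =
    \<lparr>carrier = {w. reduced w \<and> fst ` set w \<subseteq> {1..d}},
     mult = (\<lambda>u v. reduce (u @ v)),
     one = []\<rparr>"

definition gen :: "nat \<Rightarrow> word"
  where "gen i = [(i, True)]"


section \<open>Outer automorphisms\<close>

definition Inn :: "('a, 'b) monoid_scheme \<Rightarrow> ('a \<Rightarrow> 'a) set"
  where "Inn G = (\<lambda>g. \<lambda>x\<in>carrier G. g \<otimes>\<^bsub>G\<^esub> x \<otimes>\<^bsub>G\<^esub> inv\<^bsub>G\<^esub> g) ` carrier G"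

definition Out :: "('a, 'b) monoid_scheme \<Rightarrow> ('a \<Rightarrow> 'a) set monoid"
  where "Out G = AutoGroup G Mod Inn G"

definition out_class :: "('a, 'b) monoid_scheme \<Rightarrow> ('a \<Rightarrow> 'a) \<Rightarrow> ('a \<Rightarrow> 'a) set"
  where "out_class G X = Inn G #>\<^bsub>AutoGroup G\<^esub> X"


section \<open>Counting functions and the Brooks space\<close>

text \<open>Functions on the free group are represented by functions on all words, of which only the
  values on the carrier of \<^term>\<open>free_group d\<close> are ever used.\<close>

definition occ :: "word \<Rightarrow> word \<Rightarrow> real"
  where "occ v w = real (card {i. i + length v \<le> length w \<and> take (length v) (drop i w) = v})"

definition brooks_fun :: "word \<Rightarrow> word \<Rightarrow> real"
  where "brooks_fun v w = occ v w - occ (winv v) w"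

text \<open>\<open>represents d h \<alpha> f\<close>: on the free group, \<open>f\<close> is the linear combination
  of the functions \<open>h v\<close>, \<open>v \<noteq> e\<close>, with the finitely supported coefficients \<open>\<alpha>\<close>.\<close>

definition represents ::
    "nat \<Rightarrow> (word \<Rightarrow> word \<Rightarrow> real) \<Rightarrow> (word \<Rightarrow> real) \<Rightarrow> (word \<Rightarrow> real) \<Rightarrow> bool"
  where "represents d h \<alpha> f \<longleftrightarrow>
    finite {v. \<alpha> v \<noteq> 0} \<and> {v. \<alpha> v \<noteq> 0} \<subseteq> carrier (free_group d) - {[]} \<and>
    (\<forall>w\<in>carrier (free_group d). f w = (\<Sum>v | \<alpha> v \<noteq> 0. \<alpha> v * h v w))"

definition counting_functions :: "nat \<Rightarrow> (word \<Rightarrow> real) set"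
  where "counting_functions d = {f. \<exists>\<alpha>. represents d occ \<alpha> f}"

definition brooks_functions :: "nat \<Rightarrow> (word \<Rightarrow> real) set"
  where "brooks_functions d = {f. \<exists>\<alpha>. represents d brooks_fun \<alpha> f}"

text \<open>The coefficients are unique, by lemma \<open>represents_unique\<close> below.\<close>

definition coeffs :: "nat \<Rightarrow> (word \<Rightarrow> real) \<Rightarrow> word \<Rightarrow> real"
  where "coeffs d f = (THE \<alpha>. represents d occ \<alpha> f)"

definition depth :: "nat \<Rightarrow> (word \<Rightarrow> real) \<Rightarrow> nat"
  where "depth d f = Max (insert 0 (length ` {v. coeffs d f v \<noteq> 0}))"

definition equivalent :: "nat \<Rightarrow> (word \<Rightarrow> real) \<Rightarrow> (word \<Rightarrow> real) \<Rightarrow> bool"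
  where "equivalent d f g \<longleftrightarrow> (\<exists>K. \<forall>w\<in>carrier (free_group d). \<bar>f w - g w\<bar> \<le> K)"

definition equiv_class :: "nat \<Rightarrow> (word \<Rightarrow> real) \<Rightarrow> (word \<Rightarrow> real) set"
  where "equiv_class d f = {g. equivalent d g f}"

definition brooks_space :: "nat \<Rightarrow> (word \<Rightarrow> real) set set"
  where "brooks_space d = equiv_class d ` brooks_functions d"

text \<open>Since \<open>g \<sim> f\<close> means \<open>g \<in> equiv_class d f\<close>, this is the minimal depth among the counting
  functions equivalent to \<open>f\<close> when \<open>c = equiv_class d f\<close>; the minimum is over a nonempty set
  for every \<open>c\<close> that contains a counting function, and in particular on the Brooks space.\<close>

definition class_depth :: "nat \<Rightarrow> (word \<Rightarrow> real) set \<Rightarrow> nat"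
  where "class_depth d c = Inf (depth d ` (counting_functions d \<inter> c))"

text \<open>The action \<open>X[f] = [f \<circ> X\<^sup>-\<^sup>1]\<close>. All representatives of both the outer automorphism and the
  class are admitted; the result is a single class, see lemma \<open>out_action_eq\<close> below.\<close>

definition out_action ::
    "nat \<Rightarrow> (word \<Rightarrow> word) set \<Rightarrow> (word \<Rightarrow> real) set \<Rightarrow> (word \<Rightarrow> real) set"
  where "out_action d \<Phi> c =
    (\<Union>X\<in>\<Phi>. \<Union>f\<in>c. equiv_class d (f \<circ> inv\<^bsub>AutoGroup (free_group d)\<^esub> X))"


section \<open>Basic facts\<close>

lemma linv_linv [simp]: "linv (linv x) = x"
  by (simp add: linv_def)

lemma linv_neq [simp]: "linv x \<noteq> x" "x \<noteq> linv x"
  by (simp_all add: linv_def prod_eq_iff)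

lemma linv_inject [simp]: "linv x = linv y \<longleftrightarrow> x = y"
  by (metis linv_linv)

lemma reduced_tl: "reduced (x # w) \<Longrightarrow> reduced w"
  by (cases w) auto

lemma reduced_push: "reduced w \<Longrightarrow> reduced (push x w)"
  by (cases w) (auto dest: reduced_tl)

lemma push_Cons: "reduced (x # w) \<Longrightarrow> push x w = x # w"
  by (cases w) auto

lemma push_push_linv: "reduced w \<Longrightarrow> push x (push (linv x) w) = w"
  by (cases w) (auto simp: push_Cons)

lemma push_linv_push: "reduced w \<Longrightarrow> push (linv x) (push x w) = w"
  using push_push_linv[of w "linv x"] by simp

lemma reduced_foldr_push: "reduced w \<Longrightarrow> reduced (foldr push u w)"
  by (induction u) (auto intro: reduced_push)

lemma foldr_push_push: "reduced w \<Longrightarrow> foldr push (push x u) w = push x (foldr push u w)"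
  by (cases u) (auto simp: push_push_linv reduced_foldr_push)

lemma foldr_push_assoc:
  "reduced w \<Longrightarrow> foldr push (foldr push u v) w = foldr push u (foldr push v w)"
  by (induction u) (auto simp: foldr_push_push)

lemma foldr_push_Nil: "reduced w \<Longrightarrow> foldr push w [] = w"
proof (induction w)
  case (Cons x w)
  then show ?case using reduced_tl[of x w] push_Cons[of x w] by simp
qed simp

lemma reduce_append: "reduced v \<Longrightarrow> reduce (u @ v) = foldr push u v"
  by (simp add: reduce_def foldr_push_Nil)

lemma set_push: "set (push x w) \<subseteq> insert x (set w)"
  by (cases w) auto

lemma set_foldr_push: "set (foldr push u w) \<subseteq> set u \<union> set w"
  by (induction u) (use set_push in force)+

lemma mem_free_group: "w \<in> carrier (free_group d) \<longleftrightarrow> reduced w \<and> fst ` set w \<subseteq> {1..d}"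
  by (simp add: free_group_def)

lemma free_group_mult:
  "v \<in> carrier (free_group d) \<Longrightarrow> u \<otimes>\<^bsub>free_group d\<^esub> v = foldr push u v"
  by (simp add: free_group_def reduce_append)

lemma free_group_one [simp]: "\<one>\<^bsub>free_group d\<^esub> = []"
  by (simp add: free_group_def)

lemma reduced_winv: "reduced w \<Longrightarrow> reduced (winv w)"
proof -
  have app: "reduced (u @ [x, y])" if "reduced (u @ [x])" "y \<noteq> linv x" for u x y
    using that
  proof (induction u)
    case Nil
    then show ?case by simp
  next
    case (Cons a u)
    then show ?case by (cases u) auto
  qed
  show "reduced w \<Longrightarrow> reduced (winv w)"
  proof (induction w rule: reduced.induct)
    case (1 x y w)
    have "reduced (winv (y # w))" using 1 by simp
    then have "reduced (rev (map linv w) @ [linv y, linv x])"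
      using 1 by (intro app) (auto simp: winv_def)
    then show ?case by (simp add: winv_def)
  qed (auto simp: winv_def)
qed

lemma winv_closed: "w \<in> carrier (free_group d) \<Longrightarrow> winv w \<in> carrier (free_group d)"
proof -
  have "fst ` set (winv w) = fst ` set w" by (simp add: winv_def image_image linv_def)
  then show "w \<in> carrier (free_group d) \<Longrightarrow> winv w \<in> carrier (free_group d)"
    by (simp add: mem_free_group reduced_winv)
qed

lemma winv_winv [simp]: "winv (winv w) = w"
  by (simp add: winv_def rev_map comp_def)

lemma winv_l_inv: "foldr push (winv w) w = []"
proof -
  have "foldr push (winv w) (w @ v) = v" for v
    by (induction w arbitrary: v) (auto simp: winv_def)
  from this[of "[]"] show ?thesis by simp
qed

lemma foldr_push_closed:
  "u \<in> carrier (free_group d) \<Longrightarrow> w \<in> carrier (free_group d) \<Longrightarrow>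
    foldr push u w \<in> carrier (free_group d)"
  using set_foldr_push[of u w] by (fastforce simp: mem_free_group reduced_foldr_push)

lemma group_free_group: "group (free_group d)"
proof (rule groupI)
  fix x y z
  assume xyz: "x \<in> carrier (free_group d)" "y \<in> carrier (free_group d)" "z \<in> carrier (free_group d)"
  then show "x \<otimes>\<^bsub>free_group d\<^esub> y \<otimes>\<^bsub>free_group d\<^esub> z =
      x \<otimes>\<^bsub>free_group d\<^esub> (y \<otimes>\<^bsub>free_group d\<^esub> z)"
    by (simp add: free_group_mult foldr_push_closed) (simp add: foldr_push_assoc mem_free_group)
next
  fix x assume "x \<in> carrier (free_group d)"
  then show "\<exists>y\<in>carrier (free_group d). y \<otimes>\<^bsub>free_group d\<^esub> x = \<one>\<^bsub>free_group d\<^esub>"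
    by (intro bexI[of _ "winv x"]) (auto simp: winv_closed free_group_mult winv_l_inv)
next
  show "\<one>\<^bsub>free_group d\<^esub> \<in> carrier (free_group d)" by (simp add: mem_free_group)
qed (auto simp: free_group_mult foldr_push_closed)

lemma inv_free_group: "w \<in> carrier (free_group d) \<Longrightarrow> inv\<^bsub>free_group d\<^esub> w = winv w"
  by (rule group.inv_equality[OF group_free_group])
     (auto simp: winv_closed free_group_mult winv_l_inv)

lemma gen_closed: "i \<in> {1..d} \<Longrightarrow> gen i \<in> carrier (free_group d)"
  by (simp add: gen_def mem_free_group)


subsection \<open>Automorphisms\<close>

lemma carrier_AutoGroup: "carrier (AutoGroup G) = auto G"
  by (simp add: AutoGroup_def)

lemma auto_extensional: "X \<in> auto G \<Longrightarrow> X \<in> extensional (carrier G)"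
  by (simp add: auto_def Bij_def)

lemma auto_closed: "X \<in> auto G \<Longrightarrow> x \<in> carrier G \<Longrightarrow> X x \<in> carrier G"
  by (auto simp: auto_def hom_def)

lemma AutoGroup_mult:
  "X \<in> auto G \<Longrightarrow> Y \<in> auto G \<Longrightarrow> X \<otimes>\<^bsub>AutoGroup G\<^esub> Y = compose (carrier G) X Y"
  by (simp add: AutoGroup_def BijGroup_def auto_def)

lemma AutoGroup_one: "\<one>\<^bsub>AutoGroup G\<^esub> = (\<lambda>x\<in>carrier G. x)"
  by (simp add: AutoGroup_def BijGroup_def)

lemma AutoGroup_inv_apply:
  assumes "group G" "X \<in> auto G" "x \<in> carrier G"
  shows "(inv\<^bsub>AutoGroup G\<^esub> X) (X x) = x" "X ((inv\<^bsub>AutoGroup G\<^esub> X) x) = x"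
    "(inv\<^bsub>AutoGroup G\<^esub> X) x \<in> carrier G"
proof -
  interpret A: group "AutoGroup G" by (rule group.AutoGroup) fact
  have X: "X \<in> carrier (AutoGroup G)" using assms by (simp add: carrier_AutoGroup)
  have iX: "inv\<^bsub>AutoGroup G\<^esub> X \<in> auto G" using A.inv_closed[OF X] by (simp add: carrier_AutoGroup)
  have "compose (carrier G) (inv\<^bsub>AutoGroup G\<^esub> X) X x = x"
    using A.l_inv[OF X] assms iX by (simp add: AutoGroup_mult AutoGroup_one)
  then show "(inv\<^bsub>AutoGroup G\<^esub> X) (X x) = x" using assms by (simp add: compose_def)
  have "compose (carrier G) X (inv\<^bsub>AutoGroup G\<^esub> X) x = x"
    using A.r_inv[OF X] assms iX by (simp add: AutoGroup_mult AutoGroup_one)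
  then show "X ((inv\<^bsub>AutoGroup G\<^esub> X) x) = x" using assms by (simp add: compose_def)
  show "(inv\<^bsub>AutoGroup G\<^esub> X) x \<in> carrier G" using iX assms auto_closed by metis
qed

abbreviation conj_auto :: "('a, 'b) monoid_scheme \<Rightarrow> 'a \<Rightarrow> 'a \<Rightarrow> 'a"
  where "conj_auto G g \<equiv> (\<lambda>x\<in>carrier G. g \<otimes>\<^bsub>G\<^esub> x \<otimes>\<^bsub>G\<^esub> inv\<^bsub>G\<^esub> g)"

lemma (in group) conj_auto_mult:
  assumes "g \<in> carrier G" "h \<in> carrier G"
  shows "compose (carrier G) (conj_auto G g) (conj_auto G h) = conj_auto G (g \<otimes> h)"
  using assms by (auto simp: compose_def fun_eq_iff m_assoc inv_mult_group)

lemma (in group) conj_auto_auto: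
  assumes "g \<in> carrier G"
  shows "conj_auto G g \<in> auto G"
proof -
  have "conj_auto G g \<in> hom G G"
  proof (rule homI)
    fix x y assume xy: "x \<in> carrier G" "y \<in> carrier G"
    have "g \<otimes> x \<otimes> inv g \<otimes> (g \<otimes> y \<otimes> inv g) = g \<otimes> x \<otimes> (inv g \<otimes> g) \<otimes> y \<otimes> inv g"
      using assms xy by (simp only: m_assoc m_closed inv_closed)
    then show "conj_auto G g (x \<otimes> y) = conj_auto G g x \<otimes> conj_auto G g y"
      using assms xy by (simp add: m_assoc)
  qed (use assms in auto)
  moreover have "bij_betw (conj_auto G g) (carrier G) (carrier G)"
  proof (rule bij_betw_byWitness[where f' = "conj_auto G (inv g)"])
    have "compose (carrier G) (conj_auto G (inv g)) (conj_auto G g) x = x"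
        "compose (carrier G) (conj_auto G g) (conj_auto G (inv g)) x = x" if "x \<in> carrier G" for x
      using assms that by (simp_all only: conj_auto_mult inv_closed) simp_all
    then show "\<forall>x\<in>carrier G. conj_auto G (inv g) (conj_auto G g x) = x"
        "\<forall>x\<in>carrier G. conj_auto G g (conj_auto G (inv g) x) = x"
      by (simp_all only: compose_eq) blast+
  qed (use assms in auto)
  ultimately show ?thesis by (simp add: auto_def Bij_def)
qed

lemma (in group) Inn_normal: "Inn G \<lhd> AutoGroup G"
proof -
  interpret A: group "AutoGroup G" by (rule AutoGroup)
  have sub: "subgroup (Inn G) (AutoGroup G)"
  proof (rule A.subgroupI)
    show "Inn G \<subseteq> carrier (AutoGroup G)"
      by (auto simp: Inn_def carrier_AutoGroup conj_auto_auto)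
    show "Inn G \<noteq> {}" by (auto simp: Inn_def)
  next
    fix X Y assume "X \<in> Inn G" "Y \<in> Inn G"
    then show "X \<otimes>\<^bsub>AutoGroup G\<^esub> Y \<in> Inn G"
      by (auto simp: Inn_def AutoGroup_mult conj_auto_auto conj_auto_mult)
  next
    fix X assume "X \<in> Inn G"
    then obtain g where g: "g \<in> carrier G" "X = conj_auto G g" by (auto simp: Inn_def)
    have "conj_auto G (inv g) \<otimes>\<^bsub>AutoGroup G\<^esub> X = conj_auto G (inv g \<otimes> g)"
      unfolding g(2) using g(1)
      by (simp only: AutoGroup_mult conj_auto_auto conj_auto_mult inv_closed)
    also have "\<dots> = \<one>\<^bsub>AutoGroup G\<^esub>"
      using g(1) by (auto simp: AutoGroup_one fun_eq_iff)
    finally have "conj_auto G (inv g) \<otimes>\<^bsub>AutoGroup G\<^esub> X = \<one>\<^bsub>AutoGroup G\<^esub>" .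
    then have "inv\<^bsub>AutoGroup G\<^esub> X = conj_auto G (inv g)"
      using g(1) unfolding g(2)
      by (intro A.inv_equality) (simp_all only: carrier_AutoGroup conj_auto_auto inv_closed)
    then show "inv\<^bsub>AutoGroup G\<^esub> X \<in> Inn G"
      unfolding Inn_def by (rule image_eqI) (simp add: g(1))
  qed
  show ?thesis
  proof (subst A.normal_inv_iff, intro conjI ballI sub)
    fix X Y assume X: "X \<in> carrier (AutoGroup G)" and "Y \<in> Inn G"
    then obtain g where g: "g \<in> carrier G" "Y = conj_auto G g" by (auto simp: Inn_def)
    have Xa: "X \<in> auto G" and iXa: "inv\<^bsub>AutoGroup G\<^esub> X \<in> auto G"
      using X A.inv_closed[OF X] by (auto simp: carrier_AutoGroup)
    have Xh: "X \<in> hom G G" using Xa by (simp add: auto_def)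
    interpret X: group_hom G G X by (unfold_locales) (rule Xh)
    have "compose (carrier G) X Y = compose (carrier G) (conj_auto G (X g)) X"
      using g by (auto simp: compose_def fun_eq_iff)
    then have "X \<otimes>\<^bsub>AutoGroup G\<^esub> Y = conj_auto G (X g) \<otimes>\<^bsub>AutoGroup G\<^esub> X"
      using g Xa by (simp add: AutoGroup_mult conj_auto_auto)
    then have "X \<otimes>\<^bsub>AutoGroup G\<^esub> Y \<otimes>\<^bsub>AutoGroup G\<^esub> inv\<^bsub>AutoGroup G\<^esub> X = conj_auto G (X g)"
      using X A.inv_closed[OF X] A.r_inv[OF X] A.r_one[of "conj_auto G (X g)"]
        conj_auto_auto[OF X.hom_closed[OF g(1)]]
      by (simp only: A.m_assoc carrier_AutoGroup)
    then show "X \<otimes>\<^bsub>AutoGroup G\<^esub> Y \<otimes>\<^bsub>AutoGroup G\<^esub> inv\<^bsub>AutoGroup G\<^esub> X \<in> Inn G"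
      using g by (auto simp: Inn_def)
  qed
qed

lemma (in group) group_Out: "group (Out G)"
  unfolding Out_def by (rule normal.factorgroup_is_group[OF Inn_normal])


lemma (in group) out_class_closed: "X \<in> auto G \<Longrightarrow> out_class G X \<in> carrier (Out G)"
  by (auto simp: out_class_def Out_def FactGroup_def RCOSETS_def carrier_AutoGroup)

lemma (in group) out_class_hom: "group_hom (AutoGroup G) (Out G) (out_class G)"
proof -
  interpret N: normal "Inn G" "AutoGroup G" by (rule Inn_normal)
  show ?thesis
    unfolding group_hom_def group_hom_axioms_def out_class_def[abs_def]
    using N.r_coset_hom_Mod AutoGroup group_Out by (simp add: Out_def)
qed

lemma AutoGroup_nat_pow_apply:
  assumes "group G" "X \<in> auto G" "x \<in> carrier G"
  shows "(X [^]\<^bsub>AutoGroup G\<^esub> (n::nat)) x = (X ^^ n) x \<and> (X ^^ n) x \<in> carrier G"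
  using assms(3)
proof (induction n arbitrary: x)
  case 0
  then show ?case by (simp add: AutoGroup_one)
next
  case (Suc n)
  interpret A: group "AutoGroup G" by (rule group.AutoGroup) fact
  have p: "X [^]\<^bsub>AutoGroup G\<^esub> n \<in> auto G"
    using A.nat_pow_closed[of X n] assms by (simp add: carrier_AutoGroup)
  have "(X [^]\<^bsub>AutoGroup G\<^esub> Suc n) x = (X [^]\<^bsub>AutoGroup G\<^esub> n) (X x)"
    using assms Suc.prems p by (simp add: AutoGroup_mult compose_eq)
  also have "\<dots> = (X ^^ n) (X x) \<and> (X ^^ n) (X x) \<in> carrier G"
    using Suc auto_closed[OF assms(2)] by auto
  finally show ?case
    using Suc.IH[of "X x"] auto_closed[OF assms(2) Suc.prems] by (simp add: funpow_swap1)
qed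


subsection \<open>Counting functions\<close>

lemma occ_Cons:
  "occ v (x # w) = occ v w + (if take (length v) (x # w) = v then 1 else 0)"
proof -
  let ?A = "{i. i + length v \<le> length w \<and> take (length v) (drop i w) = v}"
  let ?B = "{i. i + length v \<le> length (x # w) \<and> take (length v) (drop i (x # w)) = v}"
  have fin: "finite ?A" by (rule finite_subset[of _ "{..length w}"]) auto
  have *: "length v \<le> length (x # w)" if "take (length v) (x # w) = v"
    using arg_cong[OF that, of length] by simp
  have "?B = Suc ` ?A \<union> (if take (length v) (x # w) = v then {0} else {})"
  proof (rule Set.set_eqI)
    fix i
    show "i \<in> ?B \<longleftrightarrow> i \<in> Suc ` ?A \<union> (if take (length v) (x # w) = v then {0} else {})"
      using * by (cases i) auto
  qed
  also have "card \<dots> = card ?A + (if take (length v) (x # w) = v then 1 else 0)"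
    using fin by (auto simp: card_image)
  finally show ?thesis unfolding occ_def by simp
qed

lemma occ_push: "\<bar>occ v (push x w) - occ v w\<bar> \<le> 1"
  by (cases w) (auto simp: occ_Cons)

lemma occ_foldr_push: "\<bar>occ v (foldr push u w) - occ v w\<bar> \<le> length u"
proof (induction u)
  case (Cons x u)
  then show ?case using occ_push[of v x "foldr push u w"] by simp
qed simp

lemma occ_longer: "length w < length v \<Longrightarrow> occ v w = 0"
  by (simp add: occ_def)

lemma occ_same_length: "length w = length v \<Longrightarrow> occ v w = (if v = w then 1 else 0)"
proof -
  assume l: "length w = length v"
  have "{i. i + length v \<le> length w \<and> take (length v) (drop i w) = v} = (if v = w then {0} else {})"
    unfolding l[symmetric] by auto
  then show ?thesis by (simp add: occ_def)
qed

lemma occ_winv: "occ (winv v) (winv w) = occ v w"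
proof -
  let ?S = "\<lambda>v w. {i. i + length v \<le> length w \<and> take (length v) (drop i w) = v}"
  have len: "length (winv u) = length u" for u by (simp add: winv_def)
  have *: "length w - length v - i \<in> ?S (winv v) (winv w)" if "i \<in> ?S v w" for i and v w :: word
  proof -
    from that have i: "i + length v \<le> length w" and v: "take (length v) (drop i w) = v" by auto
    have k: "length w - (length w - length v - i) = length v + i" using i by simp
    have "drop (length w - length v - i) (winv w) = rev (take (length v + i) (map linv w))"
      unfolding winv_def drop_rev length_map k ..
    also have "take (length v) \<dots> = rev (drop i (take (length v + i) (map linv w)))"
      using i by (simp only: take_rev length_take length_map min_absorb2) (simp add: min_def)
    also have "\<dots> = rev (map linv (take (length v) (drop i w)))"
      by (simp only: drop_take take_map drop_map add_diff_cancel_right')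
    finally have "take (length v) (drop (length w - length v - i) (winv w)) = winv v"
      by (simp only: v winv_def)
    then show ?thesis using i by (simp add: len)
  qed
  have "bij_betw (\<lambda>i. length w - length v - i) (?S v w) (?S (winv v) (winv w))"
  proof (rule bij_betw_byWitness[where f' = "\<lambda>i. length w - length v - i"])
    show "(\<lambda>i. length w - length v - i) ` ?S v w \<subseteq> ?S (winv v) (winv w)"
      using *[of _ v w] by auto
    show "(\<lambda>i. length w - length v - i) ` ?S (winv v) (winv w) \<subseteq> ?S v w"
      using *[of _ "winv v" "winv w"] by (auto simp: len)
  qed (auto simp: len)
  then show ?thesis by (simp add: occ_def bij_betw_same_card)
qed

lemma represents_unique:
  assumes "represents d occ \<alpha> f" "represents d occ \<beta> f"
  shows "\<alpha> = \<beta>"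
proof (rule ccontr)
  assume "\<alpha> \<noteq> \<beta>"
  let ?A = "{v. \<alpha> v \<noteq> 0}" and ?B = "{v. \<beta> v \<noteq> 0}"
  let ?D = "{v. \<alpha> v \<noteq> \<beta> v}"
  from \<open>\<alpha> \<noteq> \<beta>\<close> have "?D \<noteq> {}" by auto
  then obtain v where v: "v \<in> ?D" and min: "\<And>u. u \<in> ?D \<Longrightarrow> length v \<le> length u"
    using ex_has_least_nat[of "\<lambda>u. u \<in> ?D" _ length] by blast
  have fin: "finite (?A \<union> ?B)" using assms by (auto simp: represents_def)
  have vc: "v \<in> carrier (free_group d)" using v assms by (force simp: represents_def)
  have "f v = (\<Sum>u\<in>?A \<union> ?B. \<alpha> u * occ u v)"
    using assms(1) vc fin by (auto simp: represents_def intro!: sum.mono_neutral_left)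
  moreover have "f v = (\<Sum>u\<in>?A \<union> ?B. \<beta> u * occ u v)"
    using assms(2) vc fin by (auto simp: represents_def intro!: sum.mono_neutral_left)
  ultimately have "0 = (\<Sum>u\<in>?A \<union> ?B. (\<alpha> u - \<beta> u) * occ u v)"
    by (simp add: left_diff_distrib sum_subtractf)
  also have "\<dots> = (\<Sum>u\<in>?A \<union> ?B. if u = v then \<alpha> v - \<beta> v else 0)"
  proof (rule sum.cong)
    fix u
    show "(\<alpha> u - \<beta> u) * occ u v = (if u = v then \<alpha> v - \<beta> v else 0)"
    proof (cases "u \<in> ?D")
      case True
      then show ?thesis
        using min[of u] occ_longer[of v u] occ_same_length[of v u]
        by (cases "length u = length v") auto
    next
      case False
      then show ?thesis using v by auto
    qed
  qed simp
  also have "\<dots> = \<alpha> v - \<beta> v" using fin v by (subst sum.delta) auto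
  finally show False using v by simp
qed

lemma coeffs_eq: "represents d occ \<alpha> f \<Longrightarrow> coeffs d f = \<alpha>"
  unfolding coeffs_def by (rule the_equality) (assumption, rule represents_unique)

lemma occ_in_counting_functions:
  assumes "v \<in> carrier (free_group d)" "v \<noteq> []"
  shows "occ v \<in> counting_functions d" "depth d (occ v) = length v"
proof -
  define \<alpha> :: "word \<Rightarrow> real" where "\<alpha> = (\<lambda>u. if u = v then 1 else 0)"
  have supp: "{u. \<alpha> u \<noteq> 0} = {v}" by (simp add: \<alpha>_def)
  have rep: "represents d occ \<alpha> (occ v)"
    unfolding represents_def supp using assms by (simp add: \<alpha>_def)
  then show "occ v \<in> counting_functions d" by (auto simp: counting_functions_def)
  show "depth d (occ v) = length v"
    unfolding depth_def coeffs_eq[OF rep] supp by simp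
qed

lemma brooks_functions_subset: "brooks_functions d \<subseteq> counting_functions d"
proof
  fix f assume "f \<in> brooks_functions d"
  then obtain \<alpha> where \<alpha>: "represents d brooks_fun \<alpha> f" by (auto simp: brooks_functions_def)
  let ?A = "{v. \<alpha> v \<noteq> 0}"
  define \<beta> where "\<beta> v = \<alpha> v - \<alpha> (winv v)" for v
  let ?B = "?A \<union> winv ` ?A"
  have A: "finite ?A" "?A \<subseteq> carrier (free_group d) - {[]}"
    using \<alpha> by (auto simp: represents_def)
  have inj: "inj_on winv X" for X by (rule inj_on_inverseI[of _ winv]) simp
  have sub: "{v. \<beta> v \<noteq> 0} \<subseteq> ?B"
  proof
    fix v assume "v \<in> {v. \<beta> v \<noteq> 0}"
    then have "\<alpha> v \<noteq> 0 \<or> \<alpha> (winv v) \<noteq> 0" by (auto simp: \<beta>_def)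
    then show "v \<in> ?B" using image_eqI[of v winv "winv v" ?A] by auto
  qed
  have Bc: "?B \<subseteq> carrier (free_group d) - {[]}"
    using A(2) winv_closed by (auto simp: winv_def)
  have img: "winv ` ?B = ?B" by (simp add: image_Un image_image Un_commute)
  have "f w = (\<Sum>v | \<beta> v \<noteq> 0. \<beta> v * occ v w)" if w: "w \<in> carrier (free_group d)" for w
  proof -
    have "f w = (\<Sum>v\<in>?A. \<alpha> v * brooks_fun v w)" using \<alpha> w by (simp add: represents_def)
    also have "\<dots> = (\<Sum>v\<in>?B. \<alpha> v * brooks_fun v w)"
      using A(1) by (intro sum.mono_neutral_left) auto
    also have "\<dots> = (\<Sum>v\<in>?B. \<alpha> v * occ v w) - (\<Sum>v\<in>?B. \<alpha> v * occ (winv v) w)"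
      by (simp add: brooks_fun_def right_diff_distrib sum_subtractf)
    also have "(\<Sum>v\<in>?B. \<alpha> v * occ (winv v) w) = (\<Sum>v\<in>winv ` ?B. \<alpha> (winv v) * occ v w)"
      by (subst sum.reindex[OF inj]) simp
    also have "(\<Sum>v\<in>?B. \<alpha> v * occ v w) - \<dots> = (\<Sum>v\<in>?B. \<beta> v * occ v w)"
      unfolding img by (simp add: \<beta>_def left_diff_distrib sum_subtractf)
    also have "\<dots> = (\<Sum>v | \<beta> v \<noteq> 0. \<beta> v * occ v w)"
      using A(1) sub by (intro sum.mono_neutral_right) auto
    finally show ?thesis .
  qed
  then have "represents d occ \<beta> f"
    using A(1) sub Bc finite_subset[OF sub] unfolding represents_def by blast
  then show "f \<in> counting_functions d" by (auto simp: counting_functions_def)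
qed

lemma equivalent_refl [simp]: "equivalent d f f"
  by (auto simp: equivalent_def)

lemma equivalent_sym: "equivalent d f g \<Longrightarrow> equivalent d g f"
  by (simp add: equivalent_def abs_minus_commute)

lemma equivalent_trans: "equivalent d f g \<Longrightarrow> equivalent d g h \<Longrightarrow> equivalent d f h"
proof -
  assume "equivalent d f g" "equivalent d g h"
  then obtain K L where
    "\<forall>w\<in>carrier (free_group d). \<bar>f w - g w\<bar> \<le> K"
    "\<forall>w\<in>carrier (free_group d). \<bar>g w - h w\<bar> \<le> L"
    by (auto simp: equivalent_def)
  then have "\<forall>w\<in>carrier (free_group d). \<bar>f w - h w\<bar> \<le> K + L" by force
  then show ?thesis by (auto simp: equivalent_def)
qed

lemma equiv_class_eq_iff: "equiv_class d f = equiv_class d g \<longleftrightarrow> equivalent d f g"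
  unfolding equiv_class_def using equivalent_refl equivalent_sym equivalent_trans by blast

lemma class_depth_equiv_class:
  assumes "f \<in> counting_functions d"
  shows "class_depth d (equiv_class d f) =
    (LEAST n. \<exists>g\<in>counting_functions d. equivalent d g f \<and> depth d g = n)"
proof -
  have "f \<in> counting_functions d \<inter> equiv_class d f" using assms by (simp add: equiv_class_def)
  then have "depth d ` (counting_functions d \<inter> equiv_class d f) \<noteq> {}" by blast
  then show ?thesis
    unfolding class_depth_def Inf_nat_def
    by (auto simp: equiv_class_def intro!: arg_cong[where f = Least])
qed


subsection \<open>The action\<close>

lemma occ_conj_bounded:
  assumes "k \<in> carrier (free_group d)" "w \<in> carrier (free_group d)"
  shows "\<bar>occ v (k \<otimes>\<^bsub>free_group d\<^esub> w \<otimes>\<^bsub>free_group d\<^esub> inv\<^bsub>free_group d\<^esub> k) - occ v w\<bar>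
    \<le> 2 * length k"
proof -
  interpret group "free_group d" by (rule group_free_group)
  let ?z = "w \<otimes>\<^bsub>free_group d\<^esub> inv\<^bsub>free_group d\<^esub> k"
  have z: "?z \<in> carrier (free_group d)" using assms by simp
  have "winv ?z = k \<otimes>\<^bsub>free_group d\<^esub> winv w"
    using assms inv_free_group[OF z] inv_free_group[OF assms(2)] by (simp add: inv_mult_group)
  also have "\<dots> = foldr push k (winv w)" using assms by (simp add: free_group_mult winv_closed)
  finally have "\<bar>occ (winv v) (winv ?z) - occ (winv v) (winv w)\<bar> \<le> length k"
    using occ_foldr_push by metis
  then have "\<bar>occ v ?z - occ v w\<bar> \<le> length k" by (simp add: occ_winv)
  moreover have "\<bar>occ v (k \<otimes>\<^bsub>free_group d\<^esub> ?z) - occ v ?z\<bar> \<le> length k"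
    using occ_foldr_push z by (simp add: free_group_mult)
  moreover have "k \<otimes>\<^bsub>free_group d\<^esub> w \<otimes>\<^bsub>free_group d\<^esub> inv\<^bsub>free_group d\<^esub> k = k \<otimes>\<^bsub>free_group d\<^esub> ?z"
    using assms by (simp add: m_assoc)
  ultimately show ?thesis by simp
qed

lemma counting_conj_bounded:
  assumes "f \<in> counting_functions d" "k \<in> carrier (free_group d)"
  shows "\<exists>K. \<forall>w\<in>carrier (free_group d).
    \<bar>f (k \<otimes>\<^bsub>free_group d\<^esub> w \<otimes>\<^bsub>free_group d\<^esub> inv\<^bsub>free_group d\<^esub> k) - f w\<bar> \<le> K"
proof -
  interpret group "free_group d" by (rule group_free_group)
  obtain \<alpha> where \<alpha>: "represents d occ \<alpha> f" using assms by (auto simp: counting_functions_def)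
  let ?c = "\<lambda>w. k \<otimes>\<^bsub>free_group d\<^esub> w \<otimes>\<^bsub>free_group d\<^esub> inv\<^bsub>free_group d\<^esub> k"
  have "\<bar>f (?c w) - f w\<bar> \<le> (\<Sum>v | \<alpha> v \<noteq> 0. \<bar>\<alpha> v\<bar> * (2 * length k))"
    if w: "w \<in> carrier (free_group d)" for w
  proof -
    have "f (?c w) - f w = (\<Sum>v | \<alpha> v \<noteq> 0. \<alpha> v * (occ v (?c w) - occ v w))"
      using \<alpha> w assms(2) by (simp add: represents_def right_diff_distrib sum_subtractf)
    also have "\<bar>\<dots>\<bar> \<le> (\<Sum>v | \<alpha> v \<noteq> 0. \<bar>\<alpha> v * (occ v (?c w) - occ v w)\<bar>)" by (rule sum_abs)
    also have "\<dots> \<le> (\<Sum>v | \<alpha> v \<noteq> 0. \<bar>\<alpha> v\<bar> * (2 * length k))"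
      unfolding abs_mult using occ_conj_bounded[OF assms(2) w]
      by (intro sum_mono mult_left_mono) auto
    finally show ?thesis .
  qed
  then show ?thesis by blast
qed

lemma out_action_eq:
  assumes f: "f \<in> counting_functions d" and X: "X \<in> auto (free_group d)"
  shows "out_action d (out_class (free_group d) X) (equiv_class d f) =
    equiv_class d (f \<circ> inv\<^bsub>AutoGroup (free_group d)\<^esub> X)"
proof -
  let ?F = "free_group d"
  let ?A = "AutoGroup ?F"
  interpret F: group ?F by (rule group_free_group)
  interpret A: group ?A by (rule F.AutoGroup)
  have *: "equivalent d (g \<circ> inv\<^bsub>?A\<^esub> Y) (f \<circ> inv\<^bsub>?A\<^esub> X)"
    if Y: "Y \<in> out_class ?F X" and g: "equivalent d g f" for Y g
  proof -
    obtain k where k: "k \<in> carrier ?F" and Yk: "Y = conj_auto ?F k \<otimes>\<^bsub>?A\<^esub> X"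
      using Y by (auto simp: out_class_def r_coset_def Inn_def)
    define h where "h = (inv\<^bsub>?A\<^esub> X) k"
    have h: "h \<in> carrier ?F" unfolding h_def using AutoGroup_inv_apply(3) F.group_axioms X k by metis
    have Ya: "Y \<in> auto ?F"
      using A.m_closed[of "conj_auto ?F k" X] X k F.conj_auto_auto unfolding Yk carrier_AutoGroup by blast
    have iXh: "inv\<^bsub>?A\<^esub> X \<in> hom ?F ?F"
      using A.inv_closed[of X] X by (simp add: carrier_AutoGroup auto_def)
    interpret iX: group_hom ?F ?F "inv\<^bsub>?A\<^esub> X" by (unfold_locales) (rule iXh)
    have hY: "(inv\<^bsub>?A\<^esub> X) w = h \<otimes>\<^bsub>?F\<^esub> (inv\<^bsub>?A\<^esub> Y) w \<otimes>\<^bsub>?F\<^esub> inv\<^bsub>?F\<^esub> h"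
      if w: "w \<in> carrier ?F" for w
    proof -
      let ?u = "(inv\<^bsub>?A\<^esub> Y) w"
      have u: "?u \<in> carrier ?F" "Y ?u = w"
        using AutoGroup_inv_apply[OF F.group_axioms Ya w] by auto
      have "Y ?u = conj_auto ?F k (X ?u)"
        using AutoGroup_mult[OF F.conj_auto_auto[OF k] X] compose_eq[OF u(1), of "conj_auto ?F k" X]
        unfolding Yk by metis
      then have "w = k \<otimes>\<^bsub>?F\<^esub> X ?u \<otimes>\<^bsub>?F\<^esub> inv\<^bsub>?F\<^esub> k"
        using u auto_closed[OF X u(1)] by simp
      then have "(inv\<^bsub>?A\<^esub> X) w = (inv\<^bsub>?A\<^esub> X) (k \<otimes>\<^bsub>?F\<^esub> X ?u \<otimes>\<^bsub>?F\<^esub> inv\<^bsub>?F\<^esub> k)" by simp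
      also have "\<dots> = h \<otimes>\<^bsub>?F\<^esub> (inv\<^bsub>?A\<^esub> X) (X ?u) \<otimes>\<^bsub>?F\<^esub> inv\<^bsub>?F\<^esub> h"
        using k auto_closed[OF X u(1)] by (simp add: h_def)
      finally show ?thesis using AutoGroup_inv_apply(1)[OF F.group_axioms X u(1)] by simp
    qed
    obtain K where K: "\<forall>w\<in>carrier ?F. \<bar>f (h \<otimes>\<^bsub>?F\<^esub> w \<otimes>\<^bsub>?F\<^esub> inv\<^bsub>?F\<^esub> h) - f w\<bar> \<le> K"
      using counting_conj_bounded[OF f h] by blast
    obtain L where L: "\<forall>w\<in>carrier ?F. \<bar>g w - f w\<bar> \<le> L" using g by (auto simp: equivalent_def)
    have "\<bar>g ((inv\<^bsub>?A\<^esub> Y) w) - f ((inv\<^bsub>?A\<^esub> X) w)\<bar> \<le> K + L" if w: "w \<in> carrier ?F" for w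
    proof -
      have "(inv\<^bsub>?A\<^esub> Y) w \<in> carrier ?F" using AutoGroup_inv_apply(3)[OF F.group_axioms Ya w] .
      then have "\<bar>f ((inv\<^bsub>?A\<^esub> X) w) - f ((inv\<^bsub>?A\<^esub> Y) w)\<bar> \<le> K"
          "\<bar>g ((inv\<^bsub>?A\<^esub> Y) w) - f ((inv\<^bsub>?A\<^esub> Y) w)\<bar> \<le> L"
        using K L hY[OF w] by auto
      then show ?thesis by linarith
    qed
    then show ?thesis by (auto simp: equivalent_def)
  qed
  have "X \<in> out_class ?F X"
    using A.rcos_self[of X "Inn ?F"] F.Inn_normal X
    by (simp add: out_class_def carrier_AutoGroup normal_def)
  moreover have "f \<in> equiv_class d f" by (simp add: equiv_class_def)
  moreover have "equiv_class d (g \<circ> inv\<^bsub>?A\<^esub> Y) = equiv_class d (f \<circ> inv\<^bsub>?A\<^esub> X)"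
    if "Y \<in> out_class ?F X" "g \<in> equiv_class d f" for Y g
    using *[of Y g] that by (simp add: equiv_class_eq_iff) (simp add: equiv_class_def)
  ultimately show ?thesis unfolding out_action_def by blast
qed

lemma power_action:
  assumes f: "f \<in> counting_functions d" and T: "T \<in> auto (free_group d)"
  shows "out_action d (out_class (free_group d) T [^]\<^bsub>Out (free_group d)\<^esub> (- int n))
      (equiv_class d f) = equiv_class d (f \<circ> T ^^ n)"
proof -
  let ?F = "free_group d"
  let ?A = "AutoGroup ?F"
  interpret F: group ?F by (rule group_free_group)
  interpret A: group ?A by (rule F.AutoGroup)
  interpret h: group_hom ?A "Out ?F" "out_class ?F" by (rule F.out_class_hom)
  have Tc: "T \<in> carrier ?A" using T by (simp add: carrier_AutoGroup)
  have "out_class ?F T [^]\<^bsub>Out ?F\<^esub> (- int n) = out_class ?F (inv\<^bsub>?A\<^esub> (T [^]\<^bsub>?A\<^esub> n))"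
    using Tc by (simp add: h.H.int_pow_neg_int h.hom_nat_pow)
  moreover have "inv\<^bsub>?A\<^esub> (T [^]\<^bsub>?A\<^esub> n) \<in> auto ?F"
    using A.inv_closed[OF A.nat_pow_closed[OF Tc, of n]] by (simp add: carrier_AutoGroup)
  ultimately have "out_action d (out_class ?F T [^]\<^bsub>Out ?F\<^esub> (- int n)) (equiv_class d f) =
      equiv_class d (f \<circ> (T [^]\<^bsub>?A\<^esub> n))"
    using out_action_eq[OF f] Tc by (metis A.inv_inv A.nat_pow_closed)
  also have "\<dots> = equiv_class d (f \<circ> T ^^ n)"
    unfolding equiv_class_eq_iff equivalent_def
    using AutoGroup_nat_pow_apply[OF F.group_axioms T] by (intro exI[of _ 0]) simp
  finally show ?thesis .
qed


subsection \<open>Existence of the Nielsen transformation\<close>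

fun extend_letter :: "(nat \<Rightarrow> word) \<Rightarrow> letter \<Rightarrow> word"
  where "extend_letter h (i, b) = (if b then h i else winv (h i))"

definition extend :: "nat \<Rightarrow> (nat \<Rightarrow> word) \<Rightarrow> word \<Rightarrow> word"
  where "extend d h = (\<lambda>w\<in>carrier (free_group d).
    foldr (\<lambda>x. mult (free_group d) (extend_letter h x)) w [])"

lemma extend_hom:
  assumes h: "\<And>i. i \<in> {1..d} \<Longrightarrow> h i \<in> carrier (free_group d)"
  shows "extend d h \<in> hom (free_group d) (free_group d)"
    and "i \<in> {1..d} \<Longrightarrow> extend d h (gen i) = h i"
proof -
  let ?F = "free_group d"
  interpret F: group ?F by (rule group_free_group)
  define E where "E = (\<lambda>w. foldr (\<lambda>x. mult ?F (extend_letter h x)) w [])"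
  have E_Nil: "E [] = \<one>\<^bsub>?F\<^esub>" and E_Cons: "E (x # w) = extend_letter h x \<otimes>\<^bsub>?F\<^esub> E w" for x w
    by (simp_all add: E_def)
  have l: "extend_letter h x \<in> carrier ?F"
      "extend_letter h (linv x) = inv\<^bsub>?F\<^esub> (extend_letter h x)" if "fst x \<in> {1..d}" for x
    using that h[of "fst x"] by (cases x; auto simp: linv_def inv_free_group winv_closed)+
  have E: "E w \<in> carrier ?F" if "fst ` set w \<subseteq> {1..d}" for w
    using that by (induction w) (use l in \<open>auto simp: E_Cons E_Nil simp del: free_group_one\<close>)
  have Ep: "E (push x w) = extend_letter h x \<otimes>\<^bsub>?F\<^esub> E w"
    if "fst x \<in> {1..d}" "fst ` set w \<subseteq> {1..d}" for x w
  proof (cases w)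
    case (Cons y u)
    then show ?thesis using that l[OF that(1)] E[of u]
      by (auto simp: E_Cons F.m_assoc[symmetric] simp del: free_group_one)
  qed (simp add: E_Cons)
  have Em: "E (foldr push u w) = E u \<otimes>\<^bsub>?F\<^esub> E w"
    if "fst ` set u \<subseteq> {1..d}" "fst ` set w \<subseteq> {1..d}" for u w
    using that
  proof (induction u)
    case Nil
    then show ?case using E[of w] by (simp add: E_Nil del: free_group_one)
  next
    case (Cons x u)
    have "fst ` set (foldr push u w) \<subseteq> {1..d}" using Cons.prems set_foldr_push[of u w] by fastforce
    then show ?case using Cons l(1)[of x] E[of u] E[of w] by (simp add: Ep E_Cons F.m_assoc)
  qed
  have ext: "extend d h w = E w" if "w \<in> carrier ?F" for w
    using that by (simp add: extend_def E_def)
  show "extend d h \<in> hom ?F ?F"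
  proof (rule homI)
    fix x y assume "x \<in> carrier ?F" "y \<in> carrier ?F"
    then show "extend d h (x \<otimes>\<^bsub>?F\<^esub> y) = extend d h x \<otimes>\<^bsub>?F\<^esub> extend d h y"
      using F.m_closed[of x y] by (simp only: ext) (simp add: free_group_mult[of y] Em mem_free_group)
  qed (metis ext E mem_free_group)
  show "extend d h (gen i) = h i" if "i \<in> {1..d}"
    using that h[OF that] gen_closed[OF that]
    by (simp add: ext) (simp add: gen_def E_Cons E_Nil del: free_group_one)
qed

lemma hom_eqI:
  assumes "X \<in> hom (free_group d) (free_group d)" "Y \<in> hom (free_group d) (free_group d)"
    and gen: "\<And>i. i \<in> {1..d} \<Longrightarrow> X (gen i) = Y (gen i)"
    and "w \<in> carrier (free_group d)"
  shows "X w = Y w"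
proof -
  let ?F = "free_group d"
  interpret F: group ?F by (rule group_free_group)
  interpret X: group_hom ?F ?F X by (unfold_locales) (rule assms)
  interpret Y: group_hom ?F ?F Y by (unfold_locales) (rule assms)
  show ?thesis
    using assms(4)
  proof (induction w)
    case Nil
    show ?case using X.hom_one Y.hom_one by simp
  next
    case (Cons x w)
    have red: "reduced (x # w)" and w: "w \<in> carrier ?F" and i: "fst x \<in> {1..d}"
      using Cons.prems reduced_tl[of x w] by (auto simp: mem_free_group)
    have g: "gen (fst x) \<in> carrier ?F" using i by (rule gen_closed)
    have lx: "[x] = gen (fst x) \<or> [x] = inv\<^bsub>?F\<^esub> (gen (fst x))"
      using g by (cases x) (auto simp: inv_free_group winv_def linv_def gen_def)
    then have x: "[x] \<in> carrier ?F" using g by auto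
    have eq: "X [x] = Y [x]" using lx gen[OF i] g by auto
    have "x # w = [x] \<otimes>\<^bsub>?F\<^esub> w" using red w by (simp add: free_group_mult push_Cons)
    then show ?case using x w eq Cons.IH by simp
  qed
qed

lemma nielsen_exists:
  assumes d: "2 \<le> d"
  shows "\<exists>!T. T \<in> carrier (AutoGroup (free_group d)) \<and>
    T (gen 1) = gen 1 \<otimes>\<^bsub>free_group d\<^esub> gen 2 \<and> (\<forall>i. 2 \<le> i \<and> i \<le> d \<longrightarrow> T (gen i) = gen i)"
proof (rule ex_ex1I)
  let ?F = "free_group d"
  interpret F: group ?F by (rule group_free_group)
  define h where "h i = (if i = 1 then gen 1 \<otimes>\<^bsub>?F\<^esub> gen 2 else gen i)" for i
  define h' where "h' i = (if i = 1 then gen 1 \<otimes>\<^bsub>?F\<^esub> inv\<^bsub>?F\<^esub> gen 2 else gen i)" for i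
  have g: "gen 1 \<in> carrier ?F" "gen 2 \<in> carrier ?F" using d by (auto intro: gen_closed)
  have hc: "h i \<in> carrier ?F" "h' i \<in> carrier ?F" if "i \<in> {1..d}" for i
    using that g gen_closed[of i d] by (auto simp: h_def h'_def)
  let ?T = "extend d h" and ?U = "extend d h'"
  have T: "?T \<in> hom ?F ?F" and U: "?U \<in> hom ?F ?F" using extend_hom(1) hc by auto
  have Tg: "?T (gen i) = h i" and Ug: "?U (gen i) = h' i" if "i \<in> {1..d}" for i
    using extend_hom(2) hc that by auto
  interpret T: group_hom ?F ?F ?T by (unfold_locales) (rule T)
  interpret U: group_hom ?F ?F ?U by (unfold_locales) (rule U)
  have id: "(\<lambda>w. w) \<in> hom ?F ?F" by (simp add: hom_def)
  have TU: "(\<lambda>w. ?T (?U w)) \<in> hom ?F ?F" and UT: "(\<lambda>w. ?U (?T w)) \<in> hom ?F ?F"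
    by (auto simp: hom_def)
  have 12: "1 \<in> {1..d}" "2 \<in> {1..d}" using d by auto
  have "?T (?U (gen i)) = gen i" "?U (?T (gen i)) = gen i" if i: "i \<in> {1..d}" for i
    using Tg[OF i] Ug[OF i] Tg[OF 12(1)] Ug[OF 12(1)] Tg[OF 12(2)] Ug[OF 12(2)] g
    by (auto simp: h_def h'_def F.m_assoc simp del: free_group_one)
  then have inv: "?T (?U w) = w" "?U (?T w) = w" if "w \<in> carrier ?F" for w
    using hom_eqI[OF TU id _ that] hom_eqI[OF UT id _ that] by auto
  have "bij_betw ?T (carrier ?F) (carrier ?F)"
    by (rule bij_betw_byWitness[where f' = ?U]) (use inv in auto)
  then have "?T \<in> auto ?F" using T by (simp add: auto_def Bij_def) (simp add: extend_def)
  then have "?T \<in> carrier (AutoGroup ?F)" by (simp add: carrier_AutoGroup)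
  moreover have "?T (gen 1) = gen 1 \<otimes>\<^bsub>?F\<^esub> gen 2" using Tg[OF 12(1)] by (simp add: h_def)
  moreover have "\<forall>i. 2 \<le> i \<and> i \<le> d \<longrightarrow> ?T (gen i) = gen i" using Tg by (auto simp: h_def)
  ultimately show "\<exists>T. T \<in> carrier (AutoGroup ?F) \<and>
      T (gen 1) = gen 1 \<otimes>\<^bsub>?F\<^esub> gen 2 \<and> (\<forall>i. 2 \<le> i \<and> i \<le> d \<longrightarrow> T (gen i) = gen i)"
    by blast
next
  let ?F = "free_group d"
  fix T U
  assume T: "T \<in> carrier (AutoGroup ?F) \<and>
      T (gen 1) = gen 1 \<otimes>\<^bsub>?F\<^esub> gen 2 \<and> (\<forall>i. 2 \<le> i \<and> i \<le> d \<longrightarrow> T (gen i) = gen i)"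
    and U: "U \<in> carrier (AutoGroup ?F) \<and>
      U (gen 1) = gen 1 \<otimes>\<^bsub>?F\<^esub> gen 2 \<and> (\<forall>i. 2 \<le> i \<and> i \<le> d \<longrightarrow> U (gen i) = gen i)"
  have a: "T \<in> auto ?F" "U \<in> auto ?F" using T U by (auto simp: carrier_AutoGroup)
  have "T (gen i) = U (gen i)" if "i \<in> {1..d}" for i
    using T U that by (cases "i = 1") auto
  then have "T w = U w" if "w \<in> carrier ?F" for w
    using hom_eqI[of T d U w] a that by (auto simp: auto_def)
  then show "T = U" using a auto_extensional extensionalityI by blast
qed

end

theory Submission
  imports Defs
begin

text \<open>
  Write \<open>a\<close> and \<open>b\<close> for the first two generators, so that \<open>T\<^sup>n\<close> fixes every generator except
  \<open>a\<close>, which it sends to \<open>a b\<^sup>n\<close>. Cut a reduced word into its letters other than \<open>b\<^sup>\<plusminus>\<^sup>1\<close>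
  and the powers of \<open>b\<close> between them. Then \<open>T\<^sup>n\<close> keeps these letters and moves the exponent of a
  power of \<open>b\<close> by \<open>n\<close> if an \<open>a\<close> stands before it, by \<open>-n\<close> if an \<open>a\<^sup>-\<^sup>1\<close> stands after it, and
  by \<open>0\<close> if both or neither is the case. Since the shift between mutually inverse neighbours is
  \<open>0\<close>, no power of \<open>b\<close> that separates them disappears, and the result is reduced. This normal form
  is the function \<open>shear\<close>, and \<open>nielsen_power_eq_shear\<close> identifies it with \<open>T\<^sup>n\<close>.

  Upper bound. A function \<open>F\<close> on the group for which \<open>F (x w) - F w\<close> depends only on the first
  \<open>D\<close> letters of the reduced word \<open>x w\<close> is at bounded distance from a counting function of depth
  at most \<open>D\<close> (\<open>counting_of_local\<close>). For \<open>F w = #v(T\<^sup>n w)\<close> this holds with \<open>D\<close> linear in \<open>n\<close>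
  (\<open>occ_shear_increment_local\<close>), for the following reason. Putting a letter in front of \<open>w\<close> changes
  the exponent of the first power of \<open>b\<close> in \<open>T\<^sup>n w\<close> by at most \<open>max n 1\<close>. If the first
  power of \<open>b\<close> in \<open>w\<close> itself has an exponent beyond \<open>|v| + 2 n + 1\<close> in absolute value, then the
  number of occurrences changes linearly with the exponent, at a rate that depends only on \<open>v\<close> and the sign, and what follows has no influence. Otherwise the
  whole first power of \<open>b\<close> is visible in an initial segment of \<open>w\<close> of linear length, and only the
  next \<open>|v|\<close> letters of \<open>T\<^sup>n w\<close> matter; the same dichotomy, applied at most \<open>|v|\<close> times, shows
  that they too are read off from \<open>O(n)\<close> letters of \<open>w\<close> (\<open>shear_prefix_local\<close>).

  Lower bound. Take \<open>f\<^sub>0 = \<phi>(a a)\<close>, and consider words \<open>a b\<^sup>-\<^sup>k a b\<^sup>-\<^sup>l \<dots>\<close> with all exponents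
  \<open>k, l, \<dots>\<close> at least \<open>n - 1\<close>. A word of length at most \<open>n\<close> cannot contain two letters \<open>a\<close> there, and
  therefore the number of its occurrences depends only on the number of powers of \<open>b\<close> and the sum
  of their exponents (\<open>occ_runs\<close>). So every counting function of depth at most \<open>n\<close> takes the same
  value on the words with exponents \<open>n, n, \<dots>\<close> and \<open>n - 1, n + 1, n - 1, n + 1, \<dots>\<close>. But \<open>T\<^sup>n\<close> maps
  the first to a power of \<open>a\<close> and the second to \<open>a b a b\<^sup>-\<^sup>1 a b a b\<^sup>-\<^sup>1 \<dots>\<close>, where \<open>f\<^sub>0\<close> is
  unbounded and zero, respectively. Hence \<open>[f\<^sub>0 \<circ> T\<^sup>n]\<close> has depth greater than \<open>n\<close>.
\<close>

section \<open>Words\<close>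

lemma reduced_drop_prefix: "reduced (u @ v) \<Longrightarrow> reduced v"
  by (induction u) (auto dest: reduced_tl)

lemma reduced_take: "reduced w \<Longrightarrow> reduced (take k w)"
proof (induction w arbitrary: k rule: reduced.induct)
  case (1 x y w)
  show ?case
  proof (cases k)
    case (Suc j)
    then show ?thesis using 1 by (cases j) (auto dest: 1(1)[of "Suc _"])
  qed simp
qed (auto simp: take_Cons split: nat.split)

lemma take_closed: "w \<in> carrier (free_group d) \<Longrightarrow> take k w \<in> carrier (free_group d)"
  using set_take_subset[of k w] by (auto simp: mem_free_group reduced_take)

lemma foldr_push_append: "reduced (u @ w) \<Longrightarrow> foldr push u w = u @ w"
proof (induction u)
  case (Cons x u)
  then show ?case using reduced_tl[of x "u @ w"] push_Cons[of x "u @ w"] by simp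
qed simp

lemma tl_closed: "x # w \<in> carrier (free_group d) \<Longrightarrow> w \<in> carrier (free_group d)"
  using reduced_tl[of x w] by (simp add: mem_free_group)

lemma finite_short_words: "finite {w \<in> carrier (free_group d). length w \<le> D}"
proof (rule finite_subset)
  show "{w \<in> carrier (free_group d). length w \<le> D} \<subseteq>
      {w. set w \<subseteq> {1..d} \<times> UNIV \<and> length w \<le> D}"
    by (force simp: mem_free_group)
  show "finite {w::word. set w \<subseteq> {1..d} \<times> UNIV \<and> length w \<le> D}"
    by (rule finite_lists_length_le) simp
qed


section \<open>Locality of counting\<close>

text \<open>An occurrence of \<open>v\<close> in \<open>u @ Z\<close> that starts in \<open>u\<close> reaches less than \<open>|v|\<close> letters into \<open>Z\<close>.\<close>

lemma occ_append_local:
  assumes "length v \<le> m" "take m Z = take m Z'"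
  shows "occ v (u @ Z) - occ v Z = occ v (u @ Z') - occ v Z'"
proof -
  have t: "take j Z = take j Z'" if "j \<le> m" for j
    using arg_cong[OF assms(2), of "take j"] that by (simp add: min_absorb1)
  show ?thesis
  proof (induction u)
    case (Cons x u)
    have "take (length v) (x # u @ Z) = take (length v) (x # u @ Z')"
      using t[of "length v - Suc (length u)"] assms(1) by (cases "length v") auto
    then show ?case using Cons by (simp add: occ_Cons)
  qed simp
qed

text \<open>Once a run is about as long as \<open>v\<close>, each further letter in front of it adds an occurrence
  of \<open>v\<close> precisely when \<open>v\<close> is itself a power of that letter.\<close>

lemma occ_replicate_append:
  assumes "length v \<le> Suc j"
  shows "occ v (replicate (i + j) x @ Z) - occ v (replicate j x @ Z) =
    real i * (if v = replicate (length v) x then 1 else 0)"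
proof (induction i)
  case (Suc i)
  have "take (length v) (x # replicate (i + j) x @ Z) = replicate (length v) x"
    using assms by (cases "length v") (auto simp: min_def)
  then show ?case using Suc by (auto simp: occ_Cons algebra_simps)
qed simp

text \<open>The counting function is \<open>\<Sum> \<delta>(u) #u\<close> over the reduced words \<open>u\<close> of length \<open>D\<close>, where
  \<open>\<delta>(x w) = F (x w) - F w\<close>. By locality it has the same increments as \<open>F\<close> along all words of
  length at least \<open>D\<close>, so the difference is governed by the finitely many shorter words.\<close>

lemma counting_of_local:
  assumes D: "0 < D"
    and loc: "\<And>x w x' w'. x # w \<in> carrier (free_group d) \<Longrightarrow> x' # w' \<in> carrier (free_group d) \<Longrightarrow>
      take D (x # w) = take D (x' # w') \<Longrightarrow> F (x # w) - F w = F (x' # w') - F w'"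
  shows "\<exists>g\<in>counting_functions d. depth d g \<le> D \<and> equivalent d g F"
proof -
  let ?C = "carrier (free_group d)"
  define \<alpha> where "\<alpha> u = (if u \<in> ?C \<and> length u = D then F u - F (tl u) else 0)" for u
  define g where "g w = (\<Sum>u | \<alpha> u \<noteq> 0. \<alpha> u * occ u w)" for w
  define B where "B = {w \<in> ?C. length w \<le> D}"
  have finB: "finite B" unfolding B_def by (rule finite_short_words)
  have supp: "{u. \<alpha> u \<noteq> 0} \<subseteq> {u \<in> ?C. length u = D}" by (auto simp: \<alpha>_def split: if_splits)
  then have fin: "finite {u. \<alpha> u \<noteq> 0}" using finite_subset[OF _ finB] by (auto simp: B_def)
  have rep: "represents d occ \<alpha> g"
    unfolding represents_def using fin supp D by (auto simp: g_def)
  have gF: "g (x # w) - g w = F (x # w) - F w"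
    if xw: "x # w \<in> ?C" and len: "D \<le> length (x # w)" for x w
  proof -
    let ?t = "take D (x # w)"
    have tC: "?t \<in> ?C" using xw by (rule take_closed)
    have tl: "?t = x # take (D - 1) w" using D by (cases D) auto
    have "g (x # w) - g w = (\<Sum>u | \<alpha> u \<noteq> 0. \<alpha> u * (if take (length u) (x # w) = u then 1 else 0))"
      unfolding g_def by (simp add: occ_Cons sum_subtractf[symmetric] algebra_simps)
    also have "\<dots> = (\<Sum>u | \<alpha> u \<noteq> 0. if u = ?t then \<alpha> u else 0)"
      using supp by (intro sum.cong) auto
    also have "\<dots> = \<alpha> ?t" using fin by (simp add: sum.delta')
    also have "\<dots> = F ?t - F (tl ?t)" using tC len by (simp add: \<alpha>_def)
    also have "\<dots> = F (x # w) - F w"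
      using loc[OF tC[unfolded tl] xw] tl by (metis list.sel(3) take_take min.idem)
    finally show ?thesis .
  qed
  define K where "K = (\<Sum>u\<in>B. \<bar>g u - F u\<bar>)"
  have "\<bar>g w - F w\<bar> \<le> K" if "w \<in> ?C" for w
    using that
  proof (induction w)
    case Nil
    then show ?case unfolding K_def using finB by (intro member_le_sum) (auto simp: B_def)
  next
    case (Cons x w)
    show ?case
    proof (cases "length (x # w) \<le> D")
      case True
      then show ?thesis unfolding K_def using finB Cons.prems
        by (intro member_le_sum) (auto simp: B_def)
    next
      case False
      then show ?thesis using gF[OF Cons.prems] Cons.IH tl_closed[OF Cons.prems] by fastforce
    qed
  qed
  then have "equivalent d g F" by (auto simp: equivalent_def)
  moreover have "depth d g \<le> D"
    unfolding depth_def coeffs_eq[OF rep] using supp fin by auto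
  moreover have "g \<in> counting_functions d" using rep by (auto simp: counting_functions_def)
  ultimately show ?thesis by blast
qed


section \<open>Powers of the Nielsen transformation\<close>

definition bpow :: "int \<Rightarrow> word"
  where "bpow k = replicate (nat \<bar>k\<bar>) (2, 0 < k)"

text \<open>A letter \<open>x\<close> other than \<open>b\<^sup>\<plusminus>\<^sup>1\<close> is mapped by the \<open>n\<close>-th
  power of the Nielsen transformation to \<open>b\<^sup>-\<^sup>s x b\<^sup>t\<close> with \<open>t = tail_exp n x\<close> and
  \<open>s = tail_exp n (linv x)\<close>.\<close>

definition tail_exp :: "int \<Rightarrow> letter \<Rightarrow> int"
  where "tail_exp n x = (if x = (1, True) then n else 0)"

text \<open>The exponent of \<open>x\<close> as a power of \<open>b\<close>, meaningful for the letters with index \<open>2\<close>.\<close>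

definition bexp :: "letter \<Rightarrow> int"
  where "bexp x = (if snd x then 1 else -1)"

text \<open>The reduced word of \<open>b\<^sup>c T\<^sup>n(w)\<close> for reduced \<open>w\<close>. The accumulator \<open>c\<close> collects the
  exponent of the current power of \<open>b\<close>, which is written out only when the next other letter is
  reached; this makes the absence of cancellation visible in the recursion.\<close>

primrec shear :: "int \<Rightarrow> int \<Rightarrow> word \<Rightarrow> word"
  where
    "shear n c [] = bpow c"
  | "shear n c (x # w) =
      (if fst x = 2 then shear n (c + bexp x) w
       else bpow (c - tail_exp n (linv x)) @ x # shear n (tail_exp n x) w)"

lemma bpow_0 [simp]: "bpow 0 = []"
  by (simp add: bpow_def)

lemma length_bpow [simp]: "length (bpow k) = nat \<bar>k\<bar>"
  by (simp add: bpow_def)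

lemma bpow_inject: "bpow k = bpow l \<Longrightarrow> k = l"
  using length_bpow[of k] length_bpow[of l]
  by (cases "k = 0"; cases "l = 0") (auto simp: bpow_def split: if_splits)

lemma set_bpow: "x \<in> set (bpow k) \<Longrightarrow> fst x = 2"
  by (auto simp: bpow_def)

lemma bpow_add_bexp:
  assumes "fst x = 2" "0 \<le> k * bexp x"
  shows "bpow (k + bexp x) = x # bpow k"
proof -
  have "nat \<bar>k + bexp x\<bar> = Suc (nat \<bar>k\<bar>)" "(0 < k + bexp x) = snd x"
    using assms(2) by (auto simp: bexp_def split: if_splits)
  moreover have "k \<noteq> 0 \<Longrightarrow> (0 < k) = snd x"
    using assms(2) by (auto simp: bexp_def split: if_splits)
  moreover have "x = (2, snd x)" using assms(1) by (cases x) simp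
  ultimately show ?thesis by (cases "k = 0") (auto simp: bpow_def)
qed

lemma bpow_Cons_linv:
  assumes "fst x = 2" "k * bexp x < 0"
  shows "bpow k = linv x # bpow (k + bexp x)"
  using bpow_add_bexp[of "linv x" "k + bexp x"] assms
  by (auto simp: bexp_def linv_def split: if_splits)

lemma bpow_snoc_bexp:
  assumes "fst x = 2" "0 \<le> k * bexp x"
  shows "bpow (k + bexp x) = bpow k @ [x]"
proof (cases "k = 0")
  case False
  then have "(0 < k) = snd x" using assms(2) by (auto simp: bexp_def split: if_splits)
  then have "x = (2, 0 < k)" using assms(1) by (cases x) simp
  then show ?thesis unfolding bpow_add_bexp[OF assms] by (simp add: bpow_def replicate_append_same)
qed (use bpow_add_bexp[OF assms] in simp)

lemma bpow_same_sign:
  assumes "fst x = 2" "reduced (bpow k @ x # w)"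
  shows "0 \<le> k * bexp x"
proof (rule ccontr)
  assume neg: "\<not> 0 \<le> k * bexp x"
  then have "0 \<le> (k + bexp x) * bexp (linv x)" by (auto simp: bexp_def linv_def split: if_splits)
  then have "bpow k = bpow (k + bexp x) @ [linv x]"
    using bpow_snoc_bexp[of "linv x" "k + bexp x"] assms(1)
    by (auto simp: bexp_def linv_def split: if_splits)
  then have "reduced ([linv x] @ x # w)"
    using assms(2) reduced_drop_prefix[of "bpow (k + bexp x)" "[linv x] @ x # w"] by simp
  then show False by simp
qed

lemma push_bpow:
  assumes "reduced W" "fst x = 2"
  shows "foldr push (bpow (c + bexp x)) W = push x (foldr push (bpow c) W)"
proof (cases "0 \<le> c * bexp x")
  case True
  then show ?thesis using assms by (simp add: bpow_add_bexp)
next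
  case False
  then have "bpow c = linv x # bpow (c + bexp x)" using assms by (intro bpow_Cons_linv) auto
  then show ?thesis by (simp add: push_push_linv reduced_foldr_push assms)
qed

lemma push_bpow_add:
  assumes "reduced W"
  shows "foldr push (bpow c) (foldr push (bpow e) W) = foldr push (bpow (c + e)) W"
proof -
  have step: "foldr push (bpow (i + bexp x)) (foldr push (bpow e) W) =
      foldr push (bpow (i + bexp x + e)) W"
    if "foldr push (bpow i) (foldr push (bpow e) W) = foldr push (bpow (i + e)) W" "fst x = 2"
    for i x
    using that push_bpow[OF reduced_foldr_push[OF assms], of x i] push_bpow[OF assms, of x "i + e"]
    by (simp add: algebra_simps)
  show ?thesis
  proof (induction c rule: int_induct[where k = 0])
    case (step1 i)
    then show ?case using step[of i "(2, True)"] by (simp add: bexp_def)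
  next
    case (step2 i)
    then show ?case using step[of i "(2, False)"] by (simp add: bexp_def)
  qed simp
qed

lemma reduced_bpow_append:
  assumes "reduced w" "w = [] \<or> fst (hd w) \<noteq> 2"
  shows "reduced (bpow k @ w)"
proof -
  have "reduced (replicate j (2, s) @ w)" for j s
  proof (induction j)
    case (Suc j)
    then show ?case using assms by (cases j; cases w) (auto simp: linv_def)
  qed (use assms in simp)
  then show ?thesis by (simp add: bpow_def)
qed

lemma reduced_Cons_bpow_append:
  assumes "fst y \<noteq> 2" "reduced (z # w)" "fst z \<noteq> 2" "e = 0 \<Longrightarrow> z \<noteq> linv y"
  shows "reduced (y # bpow e @ z # w)"
proof (cases "e = 0")
  case False
  then obtain j where "nat \<bar>e\<bar> = Suc j" by (cases "nat \<bar>e\<bar>") auto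
  then show ?thesis
    using reduced_bpow_append[of "z # w" e] assms by (auto simp: bpow_def linv_def)
qed (use assms in auto)

text \<open>Adjacent mutually inverse letters \<open>y\<close> and \<open>x\<close> are the only danger. In that case \<open>y = a\<close> if
  and only if \<open>x = a\<^sup>-\<^sup>1\<close>, so the shifts at the two ends of the power of \<open>b\<close> between them cancel, and
  the exponent stays what it was in the given reduced word, hence nonzero.\<close>

lemma reduced_shear_aux:
  assumes "fst y \<noteq> 2" "reduced (y # bpow k @ w)"
  shows "reduced (y # shear n (tail_exp n y + k) w)"
  using assms
proof (induction w arbitrary: y k)
  case Nil
  show ?case
  proof (cases "bpow (tail_exp n y + k)")
    case (Cons x u)
    have "fst x = 2" using set_bpow[of x] Cons by (metis list.set_intros(1))
    then show ?thesis
      using Nil(1) reduced_bpow_append[of "[]" "tail_exp n y + k"] Cons by (auto simp: linv_def)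
  qed simp
next
  case (Cons x w)
  show ?case
  proof (cases "fst x = 2")
    case True
    have "reduced (bpow k @ x # w)" using Cons.prems(2) by (rule reduced_tl)
    then have "bpow k @ x # w = bpow (k + bexp x) @ w"
      using bpow_snoc_bexp[OF True bpow_same_sign[OF True]] by simp
    then have "reduced (y # bpow (k + bexp x) @ w)" using Cons.prems(2) by (simp only:)
    then show ?thesis
      using Cons.IH[OF Cons.prems(1), of "k + bexp x"] True by (simp add: algebra_simps)
  next
    case False
    have red: "reduced (x # w)"
      using Cons.prems(2) reduced_tl reduced_drop_prefix by blast
    have "reduced (x # shear n (tail_exp n x) w)" using Cons.IH[of x 0] red False by simp
    moreover have "x \<noteq> linv y" if "tail_exp n y + k - tail_exp n (linv x) = 0"
    proof
      assume xy: "x = linv y"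
      then have "k = 0" using that by simp
      then show False using Cons.prems(2) xy by simp
    qed
    ultimately show ?thesis using reduced_Cons_bpow_append[OF Cons.prems(1)] False by simp
  qed
qed

lemma reduced_Cons_shear:
  assumes "reduced (y # w)" "fst y \<noteq> 2"
  shows "reduced (y # shear n (tail_exp n y) w)"
  using reduced_shear_aux[of y 0 w n] assms by simp

lemma shear_bpow_append: "shear n c (bpow k @ w) = shear n (c + k) w"
proof -
  have "shear n c (replicate j x @ w) = shear n (c + int j * bexp x) w" if "fst x = 2" for j x
    using that by (induction j arbitrary: c) (simp_all add: algebra_simps)
  from this[of "(2, 0 < k)" "nat \<bar>k\<bar>"] show ?thesis by (simp add: bpow_def bexp_def)
qed

text \<open>Shears add up because they act by translation on the exponents. This is what turns the case
  \<open>n = 1\<close>, which involves the group structure, into a formula for all powers of \<open>T\<close>.\<close>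

lemma shear_shear: "shear m c (shear n e w) = shear (m + n) (c + e) w"
proof (induction w arbitrary: c e)
  case Nil
  show ?case using shear_bpow_append[of m c e "[]"] by simp
next
  case (Cons x w)
  have "tail_exp (m + n) y = tail_exp m y + tail_exp n y" for y by (simp add: tail_exp_def)
  then show ?case using Cons by (simp add: shear_bpow_append algebra_simps)
qed

lemma nielsen_eq_shear:
  assumes d: "2 \<le> d" and T: "T \<in> hom (free_group d) (free_group d)"
    and T1: "T (gen 1) = gen 1 \<otimes>\<^bsub>free_group d\<^esub> gen 2"
    and Ti: "\<And>i. 2 \<le> i \<Longrightarrow> i \<le> d \<Longrightarrow> T (gen i) = gen i"
    and w: "w \<in> carrier (free_group d)"
  shows "foldr push (bpow c) (T w) = shear 1 c w"
proof -
  let ?F = "free_group d"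
  interpret F: group ?F by (rule group_free_group)
  interpret T: group_hom ?F ?F T by (unfold_locales) (rule T)
  have T1': "T (gen 1) = [(1, True), (2, True)]"
    using T1 d by (simp add: free_group_mult gen_closed) (simp add: gen_def linv_def)
  have T_letter: "T [x] = (if fst x = 2 then [x]
      else bpow (- tail_exp 1 (linv x)) @ x # bpow (tail_exp 1 x))" if x: "fst x \<in> {1..d}" for x
  proof -
    obtain i s where xis: "x = (i, s)" by (cases x)
    have g: "gen i \<in> carrier ?F" using x xis by (simp add: gen_closed)
    have "T (inv\<^bsub>?F\<^esub> gen i) = inv\<^bsub>?F\<^esub> (T (gen i))" using g by simp
    then have "T (winv (gen i)) = winv (T (gen i))"
      using g T.hom_closed[OF g] by (simp add: inv_free_group)
    then have "T [x] = (if s then T (gen i) else winv (T (gen i)))"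
      by (simp add: xis gen_def winv_def linv_def)
    then show ?thesis using Ti[of i] T1' x xis
      by (cases "i = 1") (auto simp: tail_exp_def bpow_def linv_def winv_def gen_def)
  qed
  show ?thesis
    using w
  proof (induction w arbitrary: c)
    case Nil
    show ?case using T.hom_one foldr_push_append[of "bpow c" "[]"] reduced_bpow_append[of "[]" c]
      by simp
  next
    case (Cons x w)
    have wC: "w \<in> carrier ?F" and red: "reduced (x # w)" and x: "fst x \<in> {1..d}"
      using Cons.prems tl_closed by (auto simp: mem_free_group)
    have xC: "[x] \<in> carrier ?F" using x by (simp add: mem_free_group)
    have TwC: "T w \<in> carrier ?F" using wC by simp
    have rT: "reduced (T w)" using TwC by (simp add: mem_free_group)
    have xw: "x # w = [x] \<otimes>\<^bsub>?F\<^esub> w" using wC red by (simp add: free_group_mult push_Cons)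
    have "T (x # w) = T [x] \<otimes>\<^bsub>?F\<^esub> T w" unfolding xw using xC wC by (rule T.hom_mult)
    then have Tx: "T (x # w) = foldr push (T [x]) (T w)" using TwC by (simp add: free_group_mult)
    show ?case
    proof (cases "fst x = 2")
      case True
      then show ?thesis
        using Tx T_letter[OF x] Cons.IH[OF wC] push_bpow[OF rT True, of 0]
          push_bpow_add[OF rT, of c "bexp x"] by simp
    next
      case False
      let ?W = "shear 1 (tail_exp 1 x) w"
      have r: "reduced (x # ?W)" using red False by (rule reduced_Cons_shear)
      have "T (x # w) = foldr push (bpow (- tail_exp 1 (linv x))) (x # ?W)"
        using Tx T_letter[OF x] False Cons.IH[OF wC, of "tail_exp 1 x"] push_Cons[OF r] by simp
      then have "foldr push (bpow c) (T (x # w)) =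
          foldr push (bpow (c - tail_exp 1 (linv x))) (x # ?W)"
        using push_bpow_add[OF r] by simp
      also have "\<dots> = bpow (c - tail_exp 1 (linv x)) @ x # ?W"
        using reduced_bpow_append[OF r] False by (intro foldr_push_append) simp
      finally show ?thesis using False by simp
    qed
  qed
qed

lemma shear_0: "reduced w \<Longrightarrow> shear 0 c w = foldr push (bpow c) w"
proof (induction w arbitrary: c)
  case Nil
  then show ?case using foldr_push_append[of "bpow c" "[]"] reduced_bpow_append[of "[]" c] by simp
next
  case (Cons x w)
  note red = reduced_tl[OF Cons.prems]
  show ?case
  proof (cases "fst x = 2")
    case True
    have "x # w = foldr push (bpow (bexp x)) w"
      using push_bpow[OF red True, of 0] push_Cons[OF Cons.prems] by simp
    then have "foldr push (bpow c) (x # w) = foldr push (bpow (c + bexp x)) w"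
      using push_bpow_add[OF red, of c "bexp x"] by (simp only:)
    then show ?thesis using Cons.IH[OF red] True by simp
  next
    case False
    then show ?thesis
      using foldr_push_append[OF reduced_bpow_append[OF Cons.prems]] Cons.IH[OF red, of 0]
      by (simp add: tail_exp_def)
  qed
qed

lemma nielsen_power_eq_shear:
  assumes d: "2 \<le> d" and T: "T \<in> hom (free_group d) (free_group d)"
    and T1: "T (gen 1) = gen 1 \<otimes>\<^bsub>free_group d\<^esub> gen 2"
    and Ti: "\<And>i. 2 \<le> i \<Longrightarrow> i \<le> d \<Longrightarrow> T (gen i) = gen i"
    and w: "w \<in> carrier (free_group d)"
  shows "(T ^^ n) w = shear (int n) 0 w \<and> (T ^^ n) w \<in> carrier (free_group d)"
proof (induction n)
  case 0
  show ?case using shear_0[of w 0] w by (simp add: mem_free_group)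
next
  case (Suc n)
  then have "T ((T ^^ n) w) = shear 1 0 (shear (int n) 0 w)"
    using nielsen_eq_shear[OF d T T1 Ti conjunct2[OF Suc], of 0] by simp
  moreover have "T ((T ^^ n) w) \<in> carrier (free_group d)" using Suc T by (auto simp: hom_def)
  ultimately show ?case by (simp add: shear_shear)
qed


section \<open>Locality of the sheared counts\<close>

lemma bpow_decomposition:
  assumes "reduced w"
  obtains k r where "w = bpow k @ r" "r = [] \<or> fst (hd r) \<noteq> 2"
proof -
  have "\<exists>k r. w = bpow k @ r \<and> (r = [] \<or> fst (hd r) \<noteq> 2)"
    using assms
  proof (induction w)
    case Nil
    show ?case by (intro exI[of _ 0] exI[of _ "[]"]) simp
  next
    case (Cons x w)
    show ?case
    proof (cases "fst x = 2")
      case True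
      obtain k r where w: "w = bpow k @ r" "r = [] \<or> fst (hd r) \<noteq> 2"
        using Cons reduced_tl[of x w] by blast
      have "0 \<le> k * bexp x"
        using bpow_Cons_linv[OF True, of k] Cons.prems w(1) by (cases "k * bexp x < 0") auto
      then have "x # w = bpow (k + bexp x) @ r" using bpow_add_bexp[OF True] w(1) by simp
      then show ?thesis using w(2) by blast
    next
      case False
      then show ?thesis by (intro exI[of _ 0] exI[of _ "x # w"]) simp
    qed
  qed
  then show ?thesis using that by blast
qed

text \<open>An initial segment of a word of at least \<open>M\<close> letters either shows its first power of \<open>b\<close>
  completely, or shows that the exponent is at least \<open>M\<close> in absolute value, together with its sign.\<close>

lemma take_bpow_append_cases:
  assumes r: "r = [] \<or> fst (hd r) \<noteq> 2" and r': "r' = [] \<or> fst (hd r') \<noteq> 2"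
    and eq: "take D (bpow k @ r) = take D (bpow k' @ r')" and M: "0 < M" "M \<le> D"
  obtains (near) "k = k'" "nat \<bar>k\<bar> < M" "take (D - nat \<bar>k\<bar>) r = take (D - nat \<bar>k\<bar>) r'"
    | (far_pos) "int M \<le> k" "int M \<le> k'"
    | (far_neg) "k \<le> - int M" "k' \<le> - int M"
proof -
  have tw: "takeWhile (\<lambda>x. fst x = 2) (take D (bpow k @ r)) = take D (bpow k)"
    if "r = [] \<or> fst (hd r) \<noteq> 2" for k r
  proof -
    have "takeWhile (\<lambda>x. fst x = 2) (take D (bpow k) @ u) = take D (bpow k)"
      if "u = [] \<or> fst (hd u) \<noteq> 2" for u
      using that set_bpow[of _ k] in_set_takeD[of _ D "bpow k"]
      by (subst takeWhile_append2; cases u) auto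
    moreover have "take (D - nat \<bar>k\<bar>) r = [] \<or> fst (hd (take (D - nat \<bar>k\<bar>) r)) \<noteq> 2"
      using that by (cases "D - nat \<bar>k\<bar>"; cases r) auto
    ultimately show ?thesis by simp
  qed
  have b: "take D (bpow k) = take D (bpow k')" using tw[OF r, of k] tw[OF r', of k'] eq by simp
  show ?thesis
  proof (cases "nat \<bar>k\<bar> < D")
    case True
    have "min D (nat \<bar>k\<bar>) = min D (nat \<bar>k'\<bar>)" using arg_cong[OF b, of length] by (simp add: min.commute)
    then have "nat \<bar>k\<bar> = nat \<bar>k'\<bar>" using True by (auto simp: min_def split: if_splits)
    then have "k = k'" using b True by (intro bpow_inject) simp
    then show ?thesis using near far_pos far_neg eq M by (cases "nat \<bar>k\<bar> < M"; cases "0 \<le> k") auto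
  next
    case False
    have "D \<le> nat \<bar>k'\<bar>" using arg_cong[OF b, of length] False by (simp add: min_def split: if_splits)
    moreover have "replicate D (2::nat, 0 < k) = replicate D (2, 0 < k')"
      using b False calculation by (simp add: bpow_def min_def)
    then have "(0 < k) = (0 < k')" using M by (cases D) auto
    ultimately show ?thesis using False M far_pos far_neg by (cases "0 < k") auto
  qed
qed

text \<open>Behind the first power of \<open>b\<close>, the sheared word does not depend on the accumulator.\<close>

lemma shear_block:
  assumes "r = [] \<or> fst (hd r) \<noteq> 2" "0 \<le> n"
  obtains s Z where "0 \<le> s" "s \<le> n" "\<And>e. shear n e r = bpow (e - s) @ Z"
proof (cases r)
  case Nil
  then show ?thesis using that[of 0 "[]"] assms by simp
next
  case (Cons z u)
  then show ?thesis
    using that[of "tail_exp n (linv z)" "z # shear n (tail_exp n z) u"] assms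
    by (simp add: tail_exp_def split: if_splits)
qed

lemma take_bpow_pos: "int m \<le> e \<Longrightarrow> take m (bpow e @ Z) = replicate m (2, True)"
  by (cases m) (auto simp: bpow_def min_def)

lemma take_bpow_neg: "e \<le> - int m \<Longrightarrow> take m (bpow e @ Z) = replicate m (2, False)"
  by (cases m) (auto simp: bpow_def min_def)

text \<open>A long first power of \<open>b\<close> in \<open>w\<close> still has \<open>m\<close> letters after the shift and fills all of the
  first \<open>m\<close> places. A short one is visible, and together with the letter after it produces at least one letter of
  the result, so that at most \<open>m - 1\<close> letters remain to be determined. Each of these at most \<open>m\<close> rounds
  uses up at most \<open>m + 2 n\<close> letters of \<open>w\<close>. The bound is linear in \<open>n\<close>, since \<open>m\<close> will be the
  length of the counted word.\<close>

lemma shear_prefix_local: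
  assumes "reduced w" "reduced w'" "\<bar>c\<bar> \<le> int n"
    and "m * (m + 2 * n) \<le> D" "take D w = take D w'"
  shows "take m (shear (int n) c w) = take m (shear (int n) c w')"
  using assms
proof (induction m arbitrary: w w' c D)
  case (Suc m)
  obtain k r where w: "w = bpow k @ r" and r: "r = [] \<or> fst (hd r) \<noteq> 2"
    using bpow_decomposition Suc.prems(1) by blast
  obtain k' r' where w': "w' = bpow k' @ r'" and r': "r' = [] \<or> fst (hd r') \<noteq> 2"
    using bpow_decomposition Suc.prems(2) by blast
  define M where "M = Suc m + 2 * n"
  have D: "M + m * (m + 2 * n) \<le> D" using Suc.prems(4) by (simp add: M_def algebra_simps)
  obtain s Z where s: "0 \<le> s" "s \<le> int n" "\<And>e. shear (int n) e r = bpow (e - s) @ Z"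
    using shear_block[OF r, of "int n"] by auto
  obtain s' Z' where s': "0 \<le> s'" "s' \<le> int n" "\<And>e. shear (int n) e r' = bpow (e - s') @ Z'"
    using shear_block[OF r', of "int n"] by auto
  have sh: "shear (int n) c w = bpow (c + k - s) @ Z" "shear (int n) c w' = bpow (c + k' - s') @ Z'"
    by (simp_all add: w w' shear_bpow_append s s')
  have "0 < M" "M \<le> D" using D by (auto simp: M_def)
  from r r' Suc.prems(5)[unfolded w w'] this show ?case
  proof (cases rule: take_bpow_append_cases)
    case far_pos
    then show ?thesis unfolding sh using s s' Suc.prems(3)
      by (subst (1 2) take_bpow_pos) (auto simp: M_def)
  next
    case far_neg
    then show ?thesis unfolding sh using s s' Suc.prems(3)
      by (subst (1 2) take_bpow_neg) (auto simp: M_def)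
  next
    case near
    let ?j = "D - nat \<bar>k\<bar>"
    have j: "m * (m + 2 * n) < ?j" using near(2) D by simp
    show ?thesis
    proof (cases r)
      case Nil
      then have "r' = []" using near(3) j by (cases r') auto
      then show ?thesis using Nil near(1) w w' by simp
    next
      case (Cons z u)
      then obtain u' where r'z: "r' = z # u'" and u: "take (?j - 1) u = take (?j - 1) u'"
        using near(3) j by (cases r'; cases ?j) auto
      have "reduced u" "reduced u'"
        using Suc.prems(1,2) reduced_drop_prefix[of "bpow k @ [z]"] near(1) by (auto simp: w w' Cons r'z)
      then have t: "take m (shear (int n) (tail_exp (int n) z) u) =
          take m (shear (int n) (tail_exp (int n) z) u')"
        using u j by (intro Suc.IH[of _ _ _ "?j - 1"]) (auto simp: tail_exp_def)
      have "take i (shear (int n) (tail_exp (int n) z) u) =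
          take i (shear (int n) (tail_exp (int n) z) u')" if "i \<le> m" for i
        using arg_cong[OF t, of "take i"] that by (simp add: min_absorb1)
      moreover have "fst z \<noteq> 2" using r Cons by simp
      ultimately show ?thesis
        using near(1) by (auto simp: w w' Cons r'z shear_bpow_append take_Cons split: nat.split)
    qed
  qed
qed simp

lemma occ_bpow_append:
  assumes "length v \<le> nat \<bar>e\<bar>" "length v \<le> nat \<bar>e'\<bar>" "0 < e \<longleftrightarrow> 0 < e'"
  shows "occ v (bpow e @ Z) - occ v (bpow e' @ Z) =
    (real (nat \<bar>e\<bar>) - real (nat \<bar>e'\<bar>)) * (if v = replicate (length v) (2, 0 < e) then 1 else 0)"
  using occ_replicate_append[of v "length v" "nat \<bar>e\<bar> - length v" "(2, 0 < e)" Z]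
    occ_replicate_append[of v "length v" "nat \<bar>e'\<bar> - length v" "(2, 0 < e)" Z] assms
  by (simp add: bpow_def of_nat_diff algebra_simps split: if_splits)

text \<open>The effect on the count of changing the exponent of the first power of \<open>b\<close>. Beyond \<open>M\<close>, chosen so
  that all shifted exponents have the same sign and are at least \<open>|v|\<close> in absolute value, the count is
  an affine function of the exponent with a slope that depends only on \<open>v\<close> and the sign.\<close>

lemma shear_shift_local:
  assumes "reduced w" "reduced w'" "\<bar>c\<bar> \<le> int n + 1" "\<bar>c'\<bar> \<le> int n + 1" "length v \<le> m"
    and D: "m + 2 * n + 2 + m * (m + 2 * n) \<le> D" and eq: "take D w = take D w'"
  shows "occ v (shear (int n) c w) - occ v (shear (int n) c' w) =
    occ v (shear (int n) c w') - occ v (shear (int n) c' w')"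
proof -
  obtain k r where w: "w = bpow k @ r" and r: "r = [] \<or> fst (hd r) \<noteq> 2"
    using bpow_decomposition assms(1) by blast
  obtain k' r' where w': "w' = bpow k' @ r'" and r': "r' = [] \<or> fst (hd r') \<noteq> 2"
    using bpow_decomposition assms(2) by blast
  define M where "M = m + 2 * n + 2"
  obtain s Z where s: "0 \<le> s" "s \<le> int n" "\<And>e. shear (int n) e r = bpow (e - s) @ Z"
    using shear_block[OF r, of "int n"] by auto
  obtain s' Z' where s': "0 \<le> s'" "s' \<le> int n" "\<And>e. shear (int n) e r' = bpow (e - s') @ Z'"
    using shear_block[OF r', of "int n"] by auto
  have sh: "shear (int n) e w = bpow (e + k - s) @ Z" "shear (int n) e w' = bpow (e + k' - s') @ Z'" for e
    by (simp_all add: w w' shear_bpow_append s s')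
  have "0 < M" "M \<le> D" using D by (auto simp: M_def)
  from r r' eq[unfolded w w'] this show ?thesis
  proof (cases rule: take_bpow_append_cases)
    case far_pos
    then have "s < c + k" "s < c' + k" "s' < c + k'" "s' < c' + k'"
      using s s' assms(3,4) by (simp_all add: M_def)
    then show ?thesis unfolding sh using far_pos s s' assms(3-5)
      by (subst (1 2) occ_bpow_append) (auto simp: M_def)
  next
    case far_neg
    then have "\<not> s < c + k" "\<not> s < c' + k" "\<not> s' < c + k'" "\<not> s' < c' + k'"
      using s s' assms(3,4) by (simp_all add: M_def)
    then show ?thesis unfolding sh using far_neg s s' assms(3-5)
      by (subst (1 2) occ_bpow_append) (auto simp: M_def)
  next
    case near
    let ?j = "D - nat \<bar>k\<bar>"
    have j: "m * (m + 2 * n) < ?j" using near(2) D by (simp add: M_def)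
    show ?thesis
    proof (cases r)
      case Nil
      then have "r' = []" using near(3) j by (cases r') auto
      then show ?thesis using Nil near(1) w w' by simp
    next
      case (Cons z u)
      then obtain u' where r'z: "r' = z # u'" and u: "take (?j - 1) u = take (?j - 1) u'"
        using near(3) j by (cases r'; cases ?j) auto
      have "reduced u" "reduced u'"
        using assms(1,2) reduced_drop_prefix[of "bpow k @ [z]"] near(1) by (auto simp: w w' Cons r'z)
      then have t: "take m (shear (int n) (tail_exp (int n) z) u) =
          take m (shear (int n) (tail_exp (int n) z) u')"
        using u j by (intro shear_prefix_local[of _ _ _ _ _ "?j - 1"]) (auto simp: tail_exp_def)
      moreover have "fst z \<noteq> 2" using r Cons by simp
      ultimately show ?thesis
        using near(1) occ_append_local[OF assms(5) t, of "bpow (c + k - tail_exp (int n) (linv z)) @ [z]"]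
          occ_append_local[OF assms(5) t, of "bpow (c' + k - tail_exp (int n) (linv z)) @ [z]"]
        by (simp add: w w' Cons r'z shear_bpow_append)
    qed
  qed
qed

text \<open>A letter \<open>b\<^sup>\<plusminus>\<^sup>1\<close> in front of \<open>w\<close> just shifts the first exponent by one. Another letter \<open>x\<close> shifts it by
  its tail exponent and then puts \<open>b\<^sup>-\<^sup>s x\<close> in front of the result.\<close>

lemma occ_shear_increment_local:
  assumes red: "reduced (x # w)" "reduced (x' # w')" and v: "length v \<le> m"
    and D: "m + 2 * n + 3 + m * (m + 2 * n) \<le> D" and eq: "take D (x # w) = take D (x' # w')"
  shows "occ v (shear (int n) 0 (x # w)) - occ v (shear (int n) 0 w) =
    occ v (shear (int n) 0 (x' # w')) - occ v (shear (int n) 0 w')"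
proof -
  have x: "x' = x" and t: "take (D - 1) w = take (D - 1) w'" using eq D by (cases D; simp)+
  note r = reduced_tl[OF red(1)] reduced_tl[OF red(2)]
  have D': "m + 2 * n + 2 + m * (m + 2 * n) \<le> D - 1" using D by simp
  show ?thesis
  proof (cases "fst x = 2")
    case True
    then show ?thesis
      using shear_shift_local[OF r _ _ v D' t, of "bexp x" 0] by (simp add: x bexp_def)
  next
    case False
    let ?c = "tail_exp (int n) x" and ?u = "bpow (- tail_exp (int n) (linv x)) @ [x]"
    have c: "\<bar>?c\<bar> \<le> int n" by (simp add: tail_exp_def)
    have "take m (shear (int n) ?c w) = take m (shear (int n) ?c w')"
      using D by (intro shear_prefix_local[OF r c _ t]) simp
    from occ_append_local[OF v this, of ?u]
    show ?thesis
      using False shear_shift_local[OF r _ _ v D' t, of ?c 0] c by (simp add: x)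
  qed
qed

section \<open>Upper bound\<close>

lemma sheared_counts_linear_depth:
  fixes \<alpha> :: "word \<Rightarrow> real"
  assumes A: "finite A"
  shows "\<exists>C. \<forall>n. \<exists>g\<in>counting_functions d. depth d g \<le> C * (n + 1) \<and>
    equivalent d g (\<lambda>w. \<Sum>v\<in>A. \<alpha> v * occ v (shear (int n) 0 w))"
proof -
  obtain m where m: "\<And>v. v \<in> A \<Longrightarrow> length v \<le> m"
    using A by (metis Max_ge finite_imageI image_eqI)
  let ?C = "m * m + 2 * m + 3"
  show ?thesis
  proof (intro exI[of _ ?C] allI)
    fix n :: nat
    let ?F = "\<lambda>w. \<Sum>v\<in>A. \<alpha> v * occ v (shear (int n) 0 w)"
    define D where "D = m + 2 * n + 3 + m * (m + 2 * n)"
    have inc: "?F (x # w) - ?F w =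
        (\<Sum>v\<in>A. \<alpha> v * (occ v (shear (int n) 0 (x # w)) - occ v (shear (int n) 0 w)))" for x w
      by (simp add: sum_subtractf right_diff_distrib)
    have "\<exists>g\<in>counting_functions d. depth d g \<le> D \<and> equivalent d g ?F"
    proof (rule counting_of_local)
      fix x w x' w'
      assume "x # w \<in> carrier (free_group d)" "x' # w' \<in> carrier (free_group d)"
        and "take D (x # w) = take D (x' # w')"
      then have "occ v (shear (int n) 0 (x # w)) - occ v (shear (int n) 0 w) =
          occ v (shear (int n) 0 (x' # w')) - occ v (shear (int n) 0 w')" if "v \<in> A" for v
        using occ_shear_increment_local[OF _ _ m[OF that], of x w x' w' n D]
        by (simp add: mem_free_group D_def)
      then show "?F (x # w) - ?F w = ?F (x' # w') - ?F w'" unfolding inc by simp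
    qed (simp add: D_def)
    moreover have "D \<le> ?C * (n + 1)" by (simp add: D_def algebra_simps)
    ultimately show "\<exists>g\<in>counting_functions d. depth d g \<le> ?C * (n + 1) \<and> equivalent d g ?F"
      using le_trans by blast
  qed
qed

section \<open>Lower bound\<close>

text \<open>The word \<open>a b\<^sup>-\<^sup>k a b\<^sup>-\<^sup>l \<dots>\<close>; the negative exponents are there for \<open>T\<^sup>n\<close> to cancel.\<close>

definition runs :: "nat list \<Rightarrow> word"
  where "runs ks = concat (map (\<lambda>k. (1, True) # replicate k (2, False)) ks)"

lemma runs_simps [simp]:
  "runs [] = []" "runs (k # ks) = (1, True) # replicate k (2, False) @ runs ks"
  by (simp_all add: runs_def)

lemma runs_closed: "2 \<le> d \<Longrightarrow> runs ks \<in> carrier (free_group d)"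
proof -
  assume d: "2 \<le> d"
  have red: "reduced (x # replicate k (2, False) @ w)"
    if "reduced w" "w = [] \<or> hd w = (1, True)" "x \<in> {(1, True), (2, False)}" for x k w
    using that(3)
  proof (induction k arbitrary: x)
    case 0
    then show ?case using that(1,2) by (cases w) (auto simp: linv_def)
  next
    case (Suc k)
    then show ?case using Suc.IH[of "(2, False)"] by (auto simp: linv_def)
  qed
  have "reduced (runs ks) \<and> (runs ks = [] \<or> hd (runs ks) = (1, True))"
  proof (induction ks)
    case (Cons k ks)
    then show ?case using red[of "runs ks" "(1, True)" k] by simp
  qed simp
  then have "reduced (runs ks)" ..
  moreover have "fst ` set (runs ks) \<subseteq> {1..d}" using d by (induction ks) auto
  ultimately show ?thesis by (simp add: mem_free_group)
qed

lemma shear_runs: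
  "shear n c (runs ks) = bpow c @ concat (map (\<lambda>k. (1, True) # bpow (n - int k)) ks)"
proof (induction ks arbitrary: c)
  case (Cons k ks)
  have "replicate k (2, False) = bpow (- int k)" by (simp add: bpow_def)
  then show ?case using Cons by (simp add: shear_bpow_append tail_exp_def linv_def)
qed simp

text \<open>Putting \<open>a b\<^sup>-\<^sup>k\<close> in front of such a word adds the occurrences of \<open>v\<close> inside
  \<open>b\<^sup>-\<^sup>k\<close>, which are affine in \<open>k\<close>, and those through one of the two adjacent letters \<open>a\<close>, which do
  not depend on \<open>k\<close>. The last exponent \<open>n\<close> is kept fixed to provide the letters to the right that
  these occurrences may need.\<close>

lemma occ_runs:
  assumes n: "0 < n" and v: "length v \<le> n"
  shows "\<exists>c0 c1. \<forall>ks. (\<forall>k\<in>set ks. n - 1 \<le> k) \<longrightarrow>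
    occ v (runs (ks @ [n])) = occ v (runs [n]) + c0 * real (length ks) + c1 * real (sum_list ks)"
proof -
  let ?B = "\<lambda>k. replicate k (2::nat, False)"
  define t where "t = (1, True) # ?B (n - 1)"
  have lt: "length t = n" using n by (simp add: t_def)
  define c1 :: real where "c1 = (if v = ?B (length v) then 1 else 0)"
  define h where "h = occ v (?B (n - 1) @ t) - occ v t"
  define p :: real where "p = (if take (length v) t = v then 1 else 0)"
  have step: "occ v ((1, True) # ?B k @ w) = occ v w + (p + h - c1 * real (n - 1)) + c1 * real k"
    if k: "n - 1 \<le> k" and w: "take n w = t" for k w
  proof -
    have "take (length v) ((1, True) # ?B k @ w) = take (length v) t"
      using v k by (cases "length v") (auto simp: t_def min_def)
    moreover have "occ v (?B k @ w) = occ v (?B (n - 1) @ w) + real (k - (n - 1)) * c1"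
      using occ_replicate_append[of v "n - 1" "k - (n - 1)" "(2, False)" w] v k n
      by (simp add: c1_def split: if_splits)
    moreover have "occ v (?B (n - 1) @ w) - occ v w = h"
      unfolding h_def by (rule occ_append_local[OF v]) (simp add: w lt)
    ultimately show ?thesis using k by (simp add: occ_Cons p_def of_nat_diff algebra_simps)
  qed
  have take_run: "take n ((1, True) # ?B k @ w) = t" if "n - 1 \<le> k" for k w
    using that n by (cases n) (auto simp: t_def min_def)
  have pre: "take n (runs (ks @ [n])) = t" if "\<forall>k\<in>set ks. n - 1 \<le> k" for ks
    using that take_run take_run[of n "[]"] by (cases ks) auto
  have "occ v (runs (ks @ [n])) =
      occ v (runs [n]) + (p + h - c1 * real (n - 1)) * real (length ks) + c1 * real (sum_list ks)"
    if "\<forall>k\<in>set ks. n - 1 \<le> k" for ks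
    using that
  proof (induction ks)
    case (Cons k ks)
    then show ?case using step[of k "runs (ks @ [n])"] pre[of ks] by (simp add: algebra_simps)
  qed simp
  then show ?thesis by blast
qed

lemma counting_runs_eq:
  assumes d: "2 \<le> d" and g: "g \<in> counting_functions d" "depth d g \<le> n" and n: "0 < n"
    and ks: "\<forall>k\<in>set ks. n - 1 \<le> k" "\<forall>k\<in>set ls. n - 1 \<le> k"
    and eq: "length ks = length ls" "sum_list ks = sum_list ls"
  shows "g (runs (ks @ [n])) = g (runs (ls @ [n]))"
proof -
  obtain \<alpha> where \<alpha>: "represents d occ \<alpha> g" using g(1) by (auto simp: counting_functions_def)
  have "length v \<le> n" if "\<alpha> v \<noteq> 0" for v
  proof -
    have "length v \<le> depth d g"
      unfolding depth_def coeffs_eq[OF \<alpha>] using \<alpha> that by (intro Max_ge) (auto simp: represents_def)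
    then show ?thesis using g(2) by simp
  qed
  then have "occ v (runs (ks @ [n])) = occ v (runs (ls @ [n]))" if "\<alpha> v \<noteq> 0" for v
    using occ_runs[OF n, of v] that ks eq by fastforce
  then show ?thesis using \<alpha> runs_closed[OF d] by (auto simp: represents_def)
qed

abbreviation a_sq :: word
  where "a_sq \<equiv> [(1, True), (1, True)]"

lemma brooks_a_sq_in: "2 \<le> d \<Longrightarrow> brooks_fun a_sq \<in> brooks_functions d"
proof -
  assume d: "2 \<le> d"
  define \<alpha> :: "word \<Rightarrow> real" where "\<alpha> = (\<lambda>u. if u = a_sq then 1 else 0)"
  have supp: "{u. \<alpha> u \<noteq> 0} = {a_sq}" by (simp add: \<alpha>_def)
  have "represents d brooks_fun \<alpha> (brooks_fun a_sq)"
    unfolding represents_def supp using d by (simp add: \<alpha>_def mem_free_group linv_def)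
  then show ?thesis by (auto simp: brooks_functions_def)
qed

text \<open>The exponents \<open>n, n, \<dots>\<close> and \<open>n - 1, n + 1, \<dots>\<close> have the same sums, but a power of \<open>b\<close>
  disappears under the shear only where the exponent is exactly \<open>n\<close>.\<close>

lemma depth_sheared_a_sq:
  assumes d: "2 \<le> d" and n: "0 < n" and g: "g \<in> counting_functions d"
    and eqv: "equivalent d g (\<lambda>w. brooks_fun a_sq (shear (int n) 0 w))"
  shows "n < depth d g"
proof (rule ccontr)
  assume "\<not> n < depth d g"
  then have dep: "depth d g \<le> n" by simp
  obtain K where K: "\<And>w. w \<in> carrier (free_group d) \<Longrightarrow>
      \<bar>g w - brooks_fun a_sq (shear (int n) 0 w)\<bar> \<le> K"
    using eqv by (auto simp: equivalent_def)
  have bound: "real m \<le> K" for m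
  proof -
    let ?ks = "replicate (2 * m) n" and ?ls = "concat (replicate m [n - 1, n + 1])"
    have "shear (int n) 0 (runs (?ks @ [n])) = replicate (2 * m + 1) (1, True)"
      unfolding shear_runs by (simp add: map_replicate_const concat_replicate_single replicate_append_same)
    moreover have "brooks_fun a_sq (replicate (j + 1) (1, True)) = real j" for j
      by (induction j) (auto simp: brooks_fun_def occ_Cons winv_def linv_def occ_longer)
    ultimately have 1: "brooks_fun a_sq (shear (int n) 0 (runs (?ks @ [n]))) = real (2 * m)" by simp
    have "brooks_fun a_sq (concat (replicate m [(1, True), (2, True), (1, True), (2, False)]) @ [(1, True)]) = 0"
      by (induction m) (auto simp: brooks_fun_def occ_Cons winv_def linv_def occ_longer)
    moreover have "shear (int n) 0 (runs (?ls @ [n])) =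
        concat (replicate m [(1, True), (2, True), (1, True), (2, False)]) @ [(1, True)]"
      unfolding shear_runs using n by (induction m) (auto simp: bpow_def of_nat_diff)
    ultimately have 2: "brooks_fun a_sq (shear (int n) 0 (runs (?ls @ [n]))) = 0" by simp
    have "length ?ls = 2 * m" "sum_list ?ls = 2 * m * n"
      using n by (induction m) auto
    then have "g (runs (?ks @ [n])) = g (runs (?ls @ [n]))"
      using n by (intro counting_runs_eq[OF d g dep n]) (auto simp: sum_list_replicate)
    then show ?thesis
      using K[OF runs_closed[OF d, of "?ks @ [n]"]] K[OF runs_closed[OF d, of "?ls @ [n]"]] 1 2 by simp
  qed
  obtain m where "K < real m" using reals_Archimedean2 by blast
  with bound[of m] show False by simp
qed


section \<open>Linear speed\<close>

theorem corollary5p36: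
  fixes d :: nat and T :: "word \<Rightarrow> word"
  assumes "2 \<le> d"
    and "T \<in> carrier (AutoGroup (free_group d))"
    and "T (gen 1) = gen 1 \<otimes>\<^bsub>free_group d\<^esub> gen 2"
    and "\<And>i. 2 \<le> i \<Longrightarrow> i \<le> d \<Longrightarrow> T (gen i) = gen i"
  defines "\<tau> \<equiv> out_class (free_group d) T"
  shows "(\<forall>c\<in>brooks_space d.
            (\<lambda>n::nat. real (class_depth d
              (out_action d (\<tau> [^]\<^bsub>Out (free_group d)\<^esub> (- int n)) c))) \<in> O(\<lambda>n. real n)) \<and>
         (\<exists>c\<in>brooks_space d.
            (\<lambda>n::nat. real (class_depth d
              (out_action d (\<tau> [^]\<^bsub>Out (free_group d)\<^esub> (- int n)) c))) \<in> \<Theta>(\<lambda>n. real n))"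
proof -
  let ?F = "free_group d"
  have T: "T \<in> auto ?F" using assms(2) by (simp add: carrier_AutoGroup)
  then have hom: "T \<in> hom ?F ?F" by (simp add: auto_def)
  have pow: "(T ^^ n) w = shear (int n) 0 w \<and> (T ^^ n) w \<in> carrier ?F" if "w \<in> carrier ?F" for n w
    by (rule nielsen_power_eq_shear[OF assms(1) hom assms(3)]) (use assms(4) that in auto)
  let ?depth = "\<lambda>c n. class_depth d (out_action d (\<tau> [^]\<^bsub>Out ?F\<^esub> (- int n)) c)"
  have sheared_class: "out_action d (\<tau> [^]\<^bsub>Out ?F\<^esub> (- int n)) (equiv_class d f) =
      equiv_class d (\<lambda>w. f (shear (int n) 0 w))" if f: "f \<in> counting_functions d" for f n
  proof -
    have "equivalent d (f \<circ> T ^^ n) (\<lambda>w. f (shear (int n) 0 w))"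
      unfolding equivalent_def using pow by (intro exI[of _ 0]) simp
    then show ?thesis
      unfolding \<tau>_def power_action[OF f T] equiv_class_eq_iff .
  qed
  have linear: "\<exists>C. \<forall>n. \<exists>g\<in>counting_functions d.
      depth d g \<le> C * (n + 1) \<and> equivalent d g (\<lambda>w. f (shear (int n) 0 w))"
    if f: "f \<in> counting_functions d" for f
  proof -
    obtain \<alpha> where \<alpha>: "represents d occ \<alpha> f" using f by (auto simp: counting_functions_def)
    have "f (shear (int n) 0 w) = (\<Sum>v | \<alpha> v \<noteq> 0. \<alpha> v * occ v (shear (int n) 0 w))"
      if "w \<in> carrier ?F" for n w
      using pow[OF that, of n] \<alpha> by (auto simp: represents_def)
    then have "equivalent d g (\<lambda>w. f (shear (int n) 0 w)) \<longleftrightarrow>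
        equivalent d g (\<lambda>w. \<Sum>v | \<alpha> v \<noteq> 0. \<alpha> v * occ v (shear (int n) 0 w))" for g n
      by (simp add: equivalent_def)
    moreover have "finite {v. \<alpha> v \<noteq> 0}" using \<alpha> by (simp add: represents_def)
    ultimately show ?thesis using sheared_counts_linear_depth[of "{v. \<alpha> v \<noteq> 0}" d \<alpha>] by simp
  qed
  have upper: "(\<lambda>n. real (?depth (equiv_class d f) n)) \<in> O(\<lambda>n. real n)"
    if f: "f \<in> counting_functions d" for f
  proof -
    obtain C where C: "\<And>n. \<exists>g\<in>counting_functions d.
        depth d g \<le> C * (n + 1) \<and> equivalent d g (\<lambda>w. f (shear (int n) 0 w))"
      using linear[OF f] by blast
    have "?depth (equiv_class d f) n \<le> C * (n + 1)" for n
    proof -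
      obtain g where g: "g \<in> counting_functions d" "depth d g \<le> C * (n + 1)"
          "equivalent d g (\<lambda>w. f (shear (int n) 0 w))"
        using C by blast
      then have "class_depth d (equiv_class d (\<lambda>w. f (shear (int n) 0 w))) \<le> depth d g"
        unfolding class_depth_def by (intro cInf_lower) (auto simp: equiv_class_def)
      then show ?thesis unfolding sheared_class[OF f] using g(2) by simp
    qed
    then have "real (?depth (equiv_class d f) n) \<le> real (2 * C) * real n" if "1 \<le> n" for n
    proof -
      have "C * (n + 1) \<le> 2 * C * n" using that by (cases n) auto
      then have "?depth (equiv_class d f) n \<le> 2 * C * n"
        using \<open>?depth (equiv_class d f) n \<le> C * (n + 1)\<close> by linarith
      then show ?thesis by (metis of_nat_le_iff of_nat_mult)
    qed
    then show ?thesis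
      by (intro bigoI[of _ "real (2 * C)"] eventually_sequentiallyI[of 1]) simp
  qed
  have lower: "(\<lambda>n. real (?depth (equiv_class d (brooks_fun a_sq)) n)) \<in> \<Omega>(\<lambda>n. real n)"
  proof -
    have f: "brooks_fun a_sq \<in> counting_functions d"
      using brooks_a_sq_in[OF assms(1)] brooks_functions_subset by blast
    have "n \<le> ?depth (equiv_class d (brooks_fun a_sq)) n" if n: "1 \<le> n" for n
    proof -
      let ?S = "depth d ` (counting_functions d \<inter> equiv_class d (\<lambda>w. brooks_fun a_sq (shear (int n) 0 w)))"
      have "?S \<noteq> {}" using linear[OF f] by (auto simp: equiv_class_def)
      then have "Inf ?S \<in> ?S" by (rule Inf_nat_def1)
      then show ?thesis
        unfolding sheared_class[OF f] class_depth_def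
        using depth_sheared_a_sq[OF assms(1), of n] n by (auto simp: equiv_class_def intro: less_imp_le)
    qed
    then show ?thesis
      by (intro landau_omega.bigI[of 1] eventually_sequentiallyI[of 1]) auto
  qed
  show ?thesis
  proof
    show "\<forall>c\<in>brooks_space d. (\<lambda>n. real (?depth c n)) \<in> O(\<lambda>n. real n)"
      using upper brooks_functions_subset by (auto simp: brooks_space_def)
    have "(\<lambda>n. real (?depth (equiv_class d (brooks_fun a_sq)) n)) \<in> \<Theta>(\<lambda>n. real n)"
      using upper lower brooks_a_sq_in[OF assms(1)] brooks_functions_subset by (intro bigthetaI) auto
    then show "\<exists>c\<in>brooks_space d. (\<lambda>n. real (?depth c n)) \<in> \<Theta>(\<lambda>n. real n)"
      using brooks_a_sq_in[OF assms(1)] unfolding brooks_space_def by blast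
  qed
qed

end
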